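(* Let $\succeq$ be a quasi-order on classical terms whose induced strict order $\succ$ is a well-founded rewrite order. Then any Superposed Term Rewrite System (STRS) compatible with $\succ_w$, the strict order associated with the worst path extension $\succeq_w$ of $\succeq$, terminates.
   Context: **Syntax.** $\mathcal X$ is a countable set of variables; $\mathcal A,\mathcal C,\mathcal F$ are pairwise disjoint signatures (symbols $b$ with arity $\mathrm{ar}(b)\in\mathbb N$) of amplitude, constructor and function symbols. Constructors include a unit $()$, $|0\rangle$, $|1\rangle$, $\mathtt 0$ (arity 0), $\mathtt S$ (arity 1), pairing $(\cdot,\cdot)$ (arity 2), $[\,]$ (arity 0) and list-cons $h::t$ (arity 2). Grammar: naturals $\iota::=x\mid\mathtt 0\mid\mathtt S(\iota)$; amplitudes $\alpha::=\mathtt a(\iota,\dots,\iota)\mid\alpha\cdot\alpha\mid\alpha+\alpha$; terms $t::=x\mid c(t,\dots,t)\mid f(t,\dots,t)\mid\alpha\cdot t\mid t+t$; values $v::=c(v,\dots,v)\mid\alpha\cdot v\ (\alpha\text{ ground})\mid v+v$. A term or amplitude is ground if it has no variable; $\mathscr T_0$ is the set of ground terms. A term is classical if it contains neither $+$ nor $\alpha\cdot$. A substitution $\sigma$ maps variables to values. **Amplitudes.** Each $\mathtt a\in\mathcal A$ has a total interpretation $[\![\mathtt a]\!]:\mathbb N^{\mathrm{ar}(\mathtt a)}\to\mathbb C$, extended to ground amplitudes in the obvious way (sums to sums, products to products, $\mathtt S^n(\mathtt 0)$ to $n$). For a non-ground $\alpha$, $[\![\alpha]\!]=\lambda$ means $[\![\alpha\sigma]\!]=\lambda$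 for every $\sigma$ such that $\alpha\sigma$ is a ground amplitude. **Equivalence.** $\equiv$ is the smallest equivalence relation on terms, closed under all term contexts ($s\equiv t\Rightarrow C[s]\equiv C[t]$), with: $t_1+t_2\equiv t_2+t_1$; $t_1+(t_2+t_3)\equiv(t_1+t_2)+t_3$; $s+\alpha\cdot t\equiv s$ if $[\![\alpha]\!]=0$; $\alpha\cdot t\equiv t$ if $[\![\alpha]\!]=1$; $\alpha\cdot(\beta\cdot t)\equiv(\alpha\cdot\beta)\cdot t$; $\alpha\cdot(t_1+t_2)\equiv\alpha\cdot t_1+\alpha\cdot t_2$; $\alpha\cdot t+\beta\cdot t\equiv(\alpha+\beta)\cdot t$; and, for $b\in\mathcal C\uplus\mathcal F$, $b(\dots,\alpha\cdot t,\dots)\equiv\alpha\cdot b(\dots,t,\dots)$ and $b(\dots,t_1+t_2,\dots)\equiv b(\dots,t_1,\dots)+b(\dots,t_2,\dots)$. A canonical form of $t$ is a term $\sum_{i=1}^n\alpha_i\cdot t_i\equiv t$ with the $t_i$ pairwise distinct classical terms and $[\![\alpha_i]\!]\neq0$; $\mathrm{CAN}$ is the set of canonical forms. **STRS.** A rewrite rule is $l\to r$ with $l=f(p_1,\dots,p_n)$, $f\in\mathcal F$, each $p_i$ a classical term without function symbols, and $\mathrm{Var}(r)\subseteq\mathrm{Var}(l)$. An STRS $\mathfrak R$ consists of $\mathcal A,\mathcal C,\mathcal F,\mathcal X$, a set $\mathcal R$ of orthogonal rules (left-linear and with pairwise non-overlapping left-hand sides), and a main symbol $f\in\mathcal F$.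 **Reduction.** Evaluation contexts: $E::=\diamond\mid b(v_1,\dots,v_{i-1},E,t_{i+1},\dots,t_n)$ with $b\in\mathcal C\uplus\mathcal F$ and $v_j$ values. $\to_{\mathfrak R}\subseteq\mathscr T_0\times\mathscr T_0$ is defined inductively by: (C) if $l\to r\in\mathcal R$ and $E[l\sigma]$ is classical then $E[l\sigma]\to_{\mathfrak R}E[r\sigma]$; (E) if $s\equiv s'\to_{\mathfrak R}t'\equiv t$ then $s\to_{\mathfrak R}t$; (Q) if $\sum_i\alpha_i\cdot s_i\in\mathrm{CAN}$, $s_i\to^?_{\mathfrak R}t_i$ for all $i$, and $s_i\to_{\mathfrak R}t_i$ for some $i$, then $\sum_i\alpha_i\cdot s_i\to_{\mathfrak R}\sum_i\alpha_i\cdot t_i$. Here $s\to^?_{\mathfrak R}t$ iff ($s\in\mathrm{NF}_{\mathfrak R}$ and $t=s$) or $s\to_{\mathfrak R}t$, and $\mathrm{NF}_{\mathfrak R}$ is the set of ground terms with no $\to_{\mathfrak R}$-reduct. A term terminates if, for some $k\in\mathbb N$, all reduction chains from it reach a normal form in at most $k$ steps; an STRS terminates if every ground term terminates. **Orders.** A quasi-order $\succeq$ is a reflexive transitive relation; its strict order is $s\succ t\iff s\succeq t\wedge\neg(t\succeq s)$. $\succ$ is well-founded if there is no infinite chain $t_1\succ t_2\succ\cdots$. An order is monotonic if $s\succ t$ implies $b(\dots,s,\dots)\succ b(\dots,t,\dots)$ for all $b\in\mathcal C\uplus\mathcal F$; closed under substitutions if $s\succ t$ implies $s\sigma\succ t\sigma$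 for every substitution $\sigma$ (mapping variables to classical values); a rewrite order is a monotonic order closed under substitutions. An STRS is compatible with a strict order $\succ$ if $l\succ r$ for all its rules $l\to r$. The worst path extension $\succeq_w$ of a quasi-order $\succeq$ on classical terms is defined inductively on terms by: $s\succeq_wt$ if $s,t$ are classical and $s\succeq t$; $s\succeq_wt$ if $s\equiv\sum_{i=1}^n\alpha_i\cdot s_i\in\mathrm{CAN}$ and $s_i\succeq_wt$ for some $i$; $s\succeq_wt$ if $t\equiv\sum_{j=1}^m\beta_j\cdot t_j\in\mathrm{CAN}$ and $s\succeq_wt_j$ for all $j$. *)

theory Defs
  imports Complex_Main "HOL-Library.Countable_Set"
begin

section \<open>Syntax\<close>

datatype 'c constr =
  CUnit | CKet0 | CKet1 | CZero | CSuc | CPair | CNil | CCons | CUser 'c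

datatype ('c, 'f) symb = Constr "'c constr" | Func 'f

text \<open>
  Raw terms and amplitudes; arities, membership of the symbols in the signature, and the requirement
  that the arguments of an amplitude symbol are naturals are imposed by \<open>wf_trm\<close> and \<open>wf_amp\<close>.
  Using raw terms as arguments of amplitude symbols makes substitution a total operation: replacing a
  variable of an amplitude by a value that is not a natural gives a raw term that is not well-formed.
\<close>

datatype ('a, 'c, 'f, 'x) trm =
    Var 'x
  | App "('c, 'f) symb" "('a, 'c, 'f, 'x) trm list"
  | Scal "('a, 'c, 'f, 'x) amp" "('a, 'c, 'f, 'x) trm"
  | Plus "('a, 'c, 'f, 'x) trm" "('a, 'c, 'f, 'x) trm"
and ('a, 'c, 'f, 'x) amp =
    Amp 'a "('a, 'c, 'f, 'x) trm list"
  | Mul "('a, 'c, 'f, 'x) amp" "('a, 'c, 'f, 'x) amp"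
  | Add "('a, 'c, 'f, 'x) amp" "('a, 'c, 'f, 'x) amp"

text \<open>
  The three kinds of symbols live in different types, hence are disjoint. The field \<open>sg_constrs\<close>
  contains only the constructors other than the eight built-in ones. The value of \<open>sg_interp a\<close> matters
  only on lists whose length is the arity of \<open>a\<close>.
\<close>

record ('a, 'c, 'f, 'x) signat =
  sg_vars :: "'x set"
  sg_amps :: "'a set"
  sg_amp_arity :: "'a \<Rightarrow> nat"
  sg_interp :: "'a \<Rightarrow> nat list \<Rightarrow> complex"
  sg_constrs :: "'c set"
  sg_constr_arity :: "'c \<Rightarrow> nat"
  sg_funs :: "'f set"
  sg_fun_arity :: "'f \<Rightarrow> nat"

fun constr_arity :: "('a, 'c, 'f, 'x) signat \<Rightarrow> 'c constr \<Rightarrow> nat" where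
  "constr_arity \<Sigma> CUnit = 0"
| "constr_arity \<Sigma> CKet0 = 0"
| "constr_arity \<Sigma> CKet1 = 0"
| "constr_arity \<Sigma> CZero = 0"
| "constr_arity \<Sigma> CSuc = 1"
| "constr_arity \<Sigma> CPair = 2"
| "constr_arity \<Sigma> CNil = 0"
| "constr_arity \<Sigma> CCons = 2"
| "constr_arity \<Sigma> (CUser c) = sg_constr_arity \<Sigma> c"

fun symb_arity :: "('a, 'c, 'f, 'x) signat \<Rightarrow> ('c, 'f) symb \<Rightarrow> nat" where
  "symb_arity \<Sigma> (Constr c) = constr_arity \<Sigma> c"
| "symb_arity \<Sigma> (Func f) = sg_fun_arity \<Sigma> f"

definition symbs :: "('a, 'c, 'f, 'x) signat \<Rightarrow> ('c, 'f) symb set" where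
  "symbs \<Sigma> =
     Constr ` ({CUnit, CKet0, CKet1, CZero, CSuc, CPair, CNil, CCons} \<union> CUser ` sg_constrs \<Sigma>)
     \<union> Func ` sg_funs \<Sigma>"

fun is_nat_trm :: "('a, 'c, 'f, 'x) signat \<Rightarrow> ('a, 'c, 'f, 'x) trm \<Rightarrow> bool" where
  "is_nat_trm \<Sigma> (Var x) = (x \<in> sg_vars \<Sigma>)"
| "is_nat_trm \<Sigma> (App (Constr CZero) []) = True"
| "is_nat_trm \<Sigma> (App (Constr CSuc) [t]) = is_nat_trm \<Sigma> t"
| "is_nat_trm \<Sigma> _ = False"

fun wf_amp :: "('a, 'c, 'f, 'x) signat \<Rightarrow> ('a, 'c, 'f, 'x) amp \<Rightarrow> bool" where
  "wf_amp \<Sigma> (Amp a ts) \<longleftrightarrow>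
     a \<in> sg_amps \<Sigma> \<and> length ts = sg_amp_arity \<Sigma> a \<and> (\<forall>t\<in>set ts. is_nat_trm \<Sigma> t)"
| "wf_amp \<Sigma> (Mul \<alpha> \<beta>) \<longleftrightarrow> wf_amp \<Sigma> \<alpha> \<and> wf_amp \<Sigma> \<beta>"
| "wf_amp \<Sigma> (Add \<alpha> \<beta>) \<longleftrightarrow> wf_amp \<Sigma> \<alpha> \<and> wf_amp \<Sigma> \<beta>"

fun wf_trm :: "('a, 'c, 'f, 'x) signat \<Rightarrow> ('a, 'c, 'f, 'x) trm \<Rightarrow> bool" where
  "wf_trm \<Sigma> (Var x) \<longleftrightarrow> x \<in> sg_vars \<Sigma>"
| "wf_trm \<Sigma> (App b ts) \<longleftrightarrow>
     b \<in> symbs \<Sigma> \<and> length ts = symb_arity \<Sigma> b \<and> (\<forall>t\<in>set ts. wf_trm \<Sigma> t)"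
| "wf_trm \<Sigma> (Scal \<alpha> t) \<longleftrightarrow> wf_amp \<Sigma> \<alpha> \<and> wf_trm \<Sigma> t"
| "wf_trm \<Sigma> (Plus s t) \<longleftrightarrow> wf_trm \<Sigma> s \<and> wf_trm \<Sigma> t"

text \<open>The variables of a term, listed from left to right with repetitions.\<close>

primrec var_list :: "('a, 'c, 'f, 'x) trm \<Rightarrow> 'x list"
  and amp_var_list :: "('a, 'c, 'f, 'x) amp \<Rightarrow> 'x list" where
  "var_list (Var x) = [x]"
| "var_list (App b ts) = concat (map var_list ts)"
| "var_list (Scal \<alpha> t) = amp_var_list \<alpha> @ var_list t"
| "var_list (Plus s t) = var_list s @ var_list t"
| "amp_var_list (Amp a ts) = concat (map var_list ts)"
| "amp_var_list (Mul \<alpha> \<beta>) = amp_var_list \<alpha> @ amp_var_list \<beta>"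
| "amp_var_list (Add \<alpha> \<beta>) = amp_var_list \<alpha> @ amp_var_list \<beta>"

abbreviation vars :: "('a, 'c, 'f, 'x) trm \<Rightarrow> 'x set" where
  "vars t \<equiv> set (var_list t)"

abbreviation amp_vars :: "('a, 'c, 'f, 'x) amp \<Rightarrow> 'x set" where
  "amp_vars \<alpha> \<equiv> set (amp_var_list \<alpha>)"

definition ground_trms :: "('a, 'c, 'f, 'x) signat \<Rightarrow> ('a, 'c, 'f, 'x) trm set" where
  "ground_trms \<Sigma> = {t. wf_trm \<Sigma> t \<and> vars t = {}}"

fun classical :: "('a, 'c, 'f, 'x) trm \<Rightarrow> bool" where
  "classical (Var x) = True"
| "classical (App b ts) = (\<forall>t\<in>set ts. classical t)"
| "classical (Scal \<alpha> t) = False"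
| "classical (Plus s t) = False"

definition classical_trms :: "('a, 'c, 'f, 'x) signat \<Rightarrow> ('a, 'c, 'f, 'x) trm set" where
  "classical_trms \<Sigma> = {t. wf_trm \<Sigma> t \<and> classical t}"

fun is_value :: "('a, 'c, 'f, 'x) trm \<Rightarrow> bool" where
  "is_value (Var x) = False"
| "is_value (App (Constr c) ts) = (\<forall>t\<in>set ts. is_value t)"
| "is_value (App (Func f) ts) = False"
| "is_value (Scal \<alpha> t) = (amp_vars \<alpha> = {} \<and> is_value t)"
| "is_value (Plus s t) = (is_value s \<and> is_value t)"

text \<open>Classical terms without function symbols.\<close>

fun is_pattern :: "('a, 'c, 'f, 'x) trm \<Rightarrow> bool" where
  "is_pattern (Var x) = True"
| "is_pattern (App (Constr c) ts) = (\<forall>t\<in>set ts. is_pattern t)"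
| "is_pattern (App (Func f) ts) = False"
| "is_pattern (Scal \<alpha> t) = False"
| "is_pattern (Plus s t) = False"

primrec subst :: "('x \<Rightarrow> ('a, 'c, 'f, 'x) trm) \<Rightarrow> ('a, 'c, 'f, 'x) trm \<Rightarrow> ('a, 'c, 'f, 'x) trm"
  and amp_subst :: "('x \<Rightarrow> ('a, 'c, 'f, 'x) trm) \<Rightarrow> ('a, 'c, 'f, 'x) amp \<Rightarrow> ('a, 'c, 'f, 'x) amp"
  where
  "subst \<sigma> (Var x) = \<sigma> x"
| "subst \<sigma> (App b ts) = App b (map (subst \<sigma>) ts)"
| "subst \<sigma> (Scal \<alpha> t) = Scal (amp_subst \<sigma> \<alpha>) (subst \<sigma> t)"
| "subst \<sigma> (Plus s t) = Plus (subst \<sigma> s) (subst \<sigma> t)"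
| "amp_subst \<sigma> (Amp a ts) = Amp a (map (subst \<sigma>) ts)"
| "amp_subst \<sigma> (Mul \<alpha> \<beta>) = Mul (amp_subst \<sigma> \<alpha>) (amp_subst \<sigma> \<beta>)"
| "amp_subst \<sigma> (Add \<alpha> \<beta>) = Add (amp_subst \<sigma> \<alpha>) (amp_subst \<sigma> \<beta>)"

definition is_subst ::
  "('a, 'c, 'f, 'x) signat \<Rightarrow> ('x \<Rightarrow> ('a, 'c, 'f, 'x) trm) \<Rightarrow> bool" where
  "is_subst \<Sigma> \<sigma> \<longleftrightarrow> (\<forall>x\<in>sg_vars \<Sigma>. wf_trm \<Sigma> (\<sigma> x) \<and> is_value (\<sigma> x))"


section \<open>Amplitudes\<close>

text \<open>\<open>nat_of\<close> and \<open>amp_sem\<close> are meaningful only on ground naturals and well-formed ground amplitudes.\<close>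

fun nat_of :: "('a, 'c, 'f, 'x) trm \<Rightarrow> nat" where
  "nat_of (App (Constr CZero) []) = 0"
| "nat_of (App (Constr CSuc) [t]) = Suc (nat_of t)"
| "nat_of _ = undefined"

fun amp_sem :: "('a, 'c, 'f, 'x) signat \<Rightarrow> ('a, 'c, 'f, 'x) amp \<Rightarrow> complex" where
  "amp_sem \<Sigma> (Amp a ts) = sg_interp \<Sigma> a (map nat_of ts)"
| "amp_sem \<Sigma> (Mul \<alpha> \<beta>) = amp_sem \<Sigma> \<alpha> * amp_sem \<Sigma> \<beta>"
| "amp_sem \<Sigma> (Add \<alpha> \<beta>) = amp_sem \<Sigma> \<alpha> + amp_sem \<Sigma> \<beta>"

text \<open>
  \<open>amp_denotes \<Sigma> \<alpha> z\<close> is the statement ``the interpretation of \<open>\<alpha>\<close> equals \<open>z\<close>'', for ground and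
  non-ground \<open>\<alpha>\<close> alike; substitution leaves a ground amplitude unchanged.
\<close>

definition amp_denotes ::
  "('a, 'c, 'f, 'x) signat \<Rightarrow> ('a, 'c, 'f, 'x) amp \<Rightarrow> complex \<Rightarrow> bool" where
  "amp_denotes \<Sigma> \<alpha> z \<longleftrightarrow>
     (\<forall>\<sigma>. is_subst \<Sigma> \<sigma> \<longrightarrow> wf_amp \<Sigma> (amp_subst \<sigma> \<alpha>) \<longrightarrow> amp_vars (amp_subst \<sigma> \<alpha>) = {} \<longrightarrow>
          amp_sem \<Sigma> (amp_subst \<sigma> \<alpha>) = z)"


section \<open>Equivalence and canonical forms\<close>

inductive teq ::
  "('a, 'c, 'f, 'x) signat \<Rightarrow> ('a, 'c, 'f, 'x) trm \<Rightarrow> ('a, 'c, 'f, 'x) trm \<Rightarrow> bool"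
  for \<Sigma> :: "('a, 'c, 'f, 'x) signat" where
  teq_refl: "wf_trm \<Sigma> t \<Longrightarrow> teq \<Sigma> t t"
| teq_sym: "teq \<Sigma> s t \<Longrightarrow> teq \<Sigma> t s"
| teq_trans: "teq \<Sigma> s t \<Longrightarrow> teq \<Sigma> t u \<Longrightarrow> teq \<Sigma> s u"
| teq_ctx_app: "teq \<Sigma> s t \<Longrightarrow> wf_trm \<Sigma> (App b (ts @ s # us)) \<Longrightarrow>
    teq \<Sigma> (App b (ts @ s # us)) (App b (ts @ t # us))"
| teq_ctx_scal: "teq \<Sigma> s t \<Longrightarrow> wf_amp \<Sigma> \<alpha> \<Longrightarrow> teq \<Sigma> (Scal \<alpha> s) (Scal \<alpha> t)"
| teq_ctx_plus1: "teq \<Sigma> s t \<Longrightarrow> wf_trm \<Sigma> u \<Longrightarrow> teq \<Sigma> (Plus s u) (Plus t u)"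
| teq_ctx_plus2: "teq \<Sigma> s t \<Longrightarrow> wf_trm \<Sigma> u \<Longrightarrow> teq \<Sigma> (Plus u s) (Plus u t)"
| teq_comm: "wf_trm \<Sigma> (Plus s t) \<Longrightarrow> teq \<Sigma> (Plus s t) (Plus t s)"
| teq_assoc: "wf_trm \<Sigma> (Plus s (Plus t u)) \<Longrightarrow> teq \<Sigma> (Plus s (Plus t u)) (Plus (Plus s t) u)"
| teq_zero: "wf_trm \<Sigma> (Plus s (Scal \<alpha> t)) \<Longrightarrow> amp_denotes \<Sigma> \<alpha> 0 \<Longrightarrow>
    teq \<Sigma> (Plus s (Scal \<alpha> t)) s"
| teq_one: "wf_trm \<Sigma> (Scal \<alpha> t) \<Longrightarrow> amp_denotes \<Sigma> \<alpha> 1 \<Longrightarrow> teq \<Sigma> (Scal \<alpha> t) t"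
| teq_scal_scal: "wf_trm \<Sigma> (Scal \<alpha> (Scal \<beta> t)) \<Longrightarrow>
    teq \<Sigma> (Scal \<alpha> (Scal \<beta> t)) (Scal (Mul \<alpha> \<beta>) t)"
| teq_scal_plus: "wf_trm \<Sigma> (Scal \<alpha> (Plus s t)) \<Longrightarrow>
    teq \<Sigma> (Scal \<alpha> (Plus s t)) (Plus (Scal \<alpha> s) (Scal \<alpha> t))"
| teq_plus_scal: "wf_trm \<Sigma> (Plus (Scal \<alpha> t) (Scal \<beta> t)) \<Longrightarrow>
    teq \<Sigma> (Plus (Scal \<alpha> t) (Scal \<beta> t)) (Scal (Add \<alpha> \<beta>) t)"
| teq_app_scal: "wf_trm \<Sigma> (App b (ts @ Scal \<alpha> t # us)) \<Longrightarrow>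
    teq \<Sigma> (App b (ts @ Scal \<alpha> t # us)) (Scal \<alpha> (App b (ts @ t # us)))"
| teq_app_plus: "wf_trm \<Sigma> (App b (ts @ Plus s t # us)) \<Longrightarrow>
    teq \<Sigma> (App b (ts @ Plus s t # us)) (Plus (App b (ts @ s # us)) (App b (ts @ t # us)))"

text \<open>
  The formal sum of a non-empty list of weighted terms, bracketed to the right. The empty sum is not
  a term. Other bracketings are equivalent terms by associativity.
\<close>

fun lsum :: "(('a, 'c, 'f, 'x) amp \<times> ('a, 'c, 'f, 'x) trm) list \<Rightarrow> ('a, 'c, 'f, 'x) trm" where
  "lsum [] = undefined"
| "lsum [(\<alpha>, t)] = Scal \<alpha> t"
| "lsum ((\<alpha>, t) # p # ps) = Plus (Scal \<alpha> t) (lsum (p # ps))"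

text \<open>
  \<open>canonical \<Sigma> ps\<close> says that \<open>lsum ps\<close> is a canonical form. A non-ground coefficient is non-zero if it
  is not identically zero, i.e. this is the negation of the statement that its interpretation is 0.
\<close>

definition canonical ::
  "('a, 'c, 'f, 'x) signat \<Rightarrow> (('a, 'c, 'f, 'x) amp \<times> ('a, 'c, 'f, 'x) trm) list \<Rightarrow> bool" where
  "canonical \<Sigma> ps \<longleftrightarrow>
     ps \<noteq> [] \<and> distinct (map snd ps) \<and>
     (\<forall>(\<alpha>, t)\<in>set ps. wf_amp \<Sigma> \<alpha> \<and> \<not> amp_denotes \<Sigma> \<alpha> 0 \<and> t \<in> classical_trms \<Sigma>)"


section \<open>Superposed term rewrite systems\<close>

type_synonym ('a, 'c, 'f, 'x) rule = "('a, 'c, 'f, 'x) trm \<times> ('a, 'c, 'f, 'x) trm"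

definition is_rule :: "('a, 'c, 'f, 'x) signat \<Rightarrow> ('a, 'c, 'f, 'x) rule \<Rightarrow> bool" where
  "is_rule \<Sigma> = (\<lambda>(l, r).
     wf_trm \<Sigma> l \<and> wf_trm \<Sigma> r \<and> (\<exists>f ps. l = App (Func f) ps \<and> (\<forall>p\<in>set ps. is_pattern p)) \<and>
     vars r \<subseteq> vars l)"

fun subtrms :: "('a, 'c, 'f, 'x) trm \<Rightarrow> ('a, 'c, 'f, 'x) trm set" where
  "subtrms (Var x) = {Var x}"
| "subtrms (App b ts) = insert (App b ts) (\<Union>t\<in>set ts. subtrms t)"
| "subtrms (Scal \<alpha> t) = insert (Scal \<alpha> t) (subtrms t)"
| "subtrms (Plus s t) = insert (Plus s t) (subtrms s \<union> subtrms t)"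

text \<open>
  Two independent substitutions amount to unification after renaming the variables apart. As usual for
  overlaps, they range over all terms and not only over values.
\<close>

definition overlaps ::
  "('a, 'c, 'f, 'x) signat \<Rightarrow> ('a, 'c, 'f, 'x) trm \<Rightarrow> ('a, 'c, 'f, 'x) trm \<Rightarrow> bool" where
  "overlaps \<Sigma> l l' \<longleftrightarrow>
     (\<exists>u\<in>subtrms l. \<exists>\<sigma> \<tau>. (\<nexists>x. u = Var x) \<and>
        (\<forall>x\<in>sg_vars \<Sigma>. wf_trm \<Sigma> (\<sigma> x) \<and> wf_trm \<Sigma> (\<tau> x)) \<and> subst \<sigma> u = subst \<tau> l')"

definition orthogonal ::
  "('a, 'c, 'f, 'x) signat \<Rightarrow> ('a, 'c, 'f, 'x) rule set \<Rightarrow> bool" where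
  "orthogonal \<Sigma> \<R> \<longleftrightarrow>
     (\<forall>(l, r)\<in>\<R>. distinct (var_list l)) \<and>
     (\<forall>\<rho>\<in>\<R>. \<forall>\<rho>'\<in>\<R>. \<rho> \<noteq> \<rho>' \<longrightarrow> \<not> overlaps \<Sigma> (fst \<rho>) (fst \<rho>'))"

definition is_strs ::
  "('a, 'c, 'f, 'x) signat \<Rightarrow> ('a, 'c, 'f, 'x) rule set \<Rightarrow> 'f \<Rightarrow> bool" where
  "is_strs \<Sigma> \<R> f \<longleftrightarrow>
     countable (sg_vars \<Sigma>) \<and> (\<forall>\<rho>\<in>\<R>. is_rule \<Sigma> \<rho>) \<and> orthogonal \<Sigma> \<R> \<and> f \<in> sg_funs \<Sigma>"


section \<open>Reduction\<close>

datatype ('a, 'c, 'f, 'x) ectx =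
    Hole
  | CApp "('c, 'f) symb" "('a, 'c, 'f, 'x) trm list" "('a, 'c, 'f, 'x) ectx"
      "('a, 'c, 'f, 'x) trm list"

primrec plug :: "('a, 'c, 'f, 'x) ectx \<Rightarrow> ('a, 'c, 'f, 'x) trm \<Rightarrow> ('a, 'c, 'f, 'x) trm" where
  "plug Hole s = s"
| "plug (CApp b vs E ts) s = App b (vs @ plug E s # ts)"

primrec is_ectx :: "('a, 'c, 'f, 'x) ectx \<Rightarrow> bool" where
  "is_ectx Hole = True"
| "is_ectx (CApp b vs E ts) = ((\<forall>v\<in>set vs. is_value v) \<and> is_ectx E)"

definition NF_of ::
  "('a, 'c, 'f, 'x) signat \<Rightarrow> (('a, 'c, 'f, 'x) trm \<Rightarrow> ('a, 'c, 'f, 'x) trm \<Rightarrow> bool) \<Rightarrow>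
    ('a, 'c, 'f, 'x) trm set" where
  "NF_of \<Sigma> rel = {s \<in> ground_trms \<Sigma>. \<nexists>t. rel s t}"

text \<open>
  The reduction relation is defined by rules, one of which refers to the normal forms of the relation
  itself, negatively. So \<open>red_wrt\<close> is the relation inductively generated by the rules when \<open>N\<close> is
  used as set of normal forms, and \<open>red\<close> is the relation that is generated by the rules from its own
  normal forms. That there is exactly one such relation is shown below (\<open>red_unique\<close>).
\<close>

inductive red_wrt ::
  "('a, 'c, 'f, 'x) signat \<Rightarrow> ('a, 'c, 'f, 'x) rule set \<Rightarrow> ('a, 'c, 'f, 'x) trm set \<Rightarrow>
    ('a, 'c, 'f, 'x) trm \<Rightarrow> ('a, 'c, 'f, 'x) trm \<Rightarrow> bool"
  for \<Sigma> :: "('a, 'c, 'f, 'x) signat" and \<R> :: "('a, 'c, 'f, 'x) rule set"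
    and N :: "('a, 'c, 'f, 'x) trm set" where
  red_C: "(l, r) \<in> \<R> \<Longrightarrow> is_subst \<Sigma> \<sigma> \<Longrightarrow> is_ectx E \<Longrightarrow> classical (plug E (subst \<sigma> l)) \<Longrightarrow>
    plug E (subst \<sigma> l) \<in> ground_trms \<Sigma> \<Longrightarrow> plug E (subst \<sigma> r) \<in> ground_trms \<Sigma> \<Longrightarrow>
    red_wrt \<Sigma> \<R> N (plug E (subst \<sigma> l)) (plug E (subst \<sigma> r))"
| red_E: "s \<in> ground_trms \<Sigma> \<Longrightarrow> t \<in> ground_trms \<Sigma> \<Longrightarrow>
    teq \<Sigma> s s' \<Longrightarrow> red_wrt \<Sigma> \<R> N s' t' \<Longrightarrow> teq \<Sigma> t' t \<Longrightarrow> red_wrt \<Sigma> \<R> N s t"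
| red_Q: "canonical \<Sigma> (map (\<lambda>(\<alpha>, s, t). (\<alpha>, s)) ps) \<Longrightarrow>
    lsum (map (\<lambda>(\<alpha>, s, t). (\<alpha>, s)) ps) \<in> ground_trms \<Sigma> \<Longrightarrow>
    \<forall>(\<alpha>, s, t)\<in>set ps. s \<in> N \<and> t = s \<or> red_wrt \<Sigma> \<R> N s t \<Longrightarrow>
    \<exists>(\<alpha>, s, t)\<in>set ps. red_wrt \<Sigma> \<R> N s t \<Longrightarrow>
    red_wrt \<Sigma> \<R> N (lsum (map (\<lambda>(\<alpha>, s, t). (\<alpha>, s)) ps)) (lsum (map (\<lambda>(\<alpha>, s, t). (\<alpha>, t)) ps))"

definition red ::
  "('a, 'c, 'f, 'x) signat \<Rightarrow> ('a, 'c, 'f, 'x) rule set \<Rightarrow>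
    ('a, 'c, 'f, 'x) trm \<Rightarrow> ('a, 'c, 'f, 'x) trm \<Rightarrow> bool" where
  "red \<Sigma> \<R> = (THE rel. rel = red_wrt \<Sigma> \<R> (NF_of \<Sigma> rel))"

definition NF :: "('a, 'c, 'f, 'x) signat \<Rightarrow> ('a, 'c, 'f, 'x) rule set \<Rightarrow> ('a, 'c, 'f, 'x) trm set"
  where "NF \<Sigma> \<R> = NF_of \<Sigma> (red \<Sigma> \<R>)"

definition red_opt ::
  "('a, 'c, 'f, 'x) signat \<Rightarrow> ('a, 'c, 'f, 'x) rule set \<Rightarrow>
    ('a, 'c, 'f, 'x) trm \<Rightarrow> ('a, 'c, 'f, 'x) trm \<Rightarrow> bool" where
  "red_opt \<Sigma> \<R> s t \<longleftrightarrow> s \<in> NF \<Sigma> \<R> \<and> t = s \<or> red \<Sigma> \<R> s t"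

text \<open>
  Chains are represented as infinite sequences that can be stationary only once a normal form is
  reached.
\<close>

definition terminates ::
  "('a, 'c, 'f, 'x) signat \<Rightarrow> ('a, 'c, 'f, 'x) rule set \<Rightarrow> ('a, 'c, 'f, 'x) trm \<Rightarrow> bool" where
  "terminates \<Sigma> \<R> t \<longleftrightarrow>
     (\<exists>k::nat. \<forall>ch. ch 0 = t \<and> (\<forall>i. red_opt \<Sigma> \<R> (ch i) (ch (Suc i))) \<longrightarrow> (\<exists>i\<le>k. ch i \<in> NF \<Sigma> \<R>))"

definition strs_terminates ::
  "('a, 'c, 'f, 'x) signat \<Rightarrow> ('a, 'c, 'f, 'x) rule set \<Rightarrow> bool" where
  "strs_terminates \<Sigma> \<R> \<longleftrightarrow> (\<forall>t\<in>ground_trms \<Sigma>. terminates \<Sigma> \<R> t)"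


subsection \<open>The reduction relation is well defined\<close>

text \<open>
  The coefficient of a classical term \<open>u\<close> in a term, where the variables in amplitudes are set to 0,
  is invariant under equivalence. Hence a classical term is reducible iff rule \<open>red_C\<close> applies to it,
  whatever the set \<open>N\<close> is, and the rule \<open>red_Q\<close> uses \<open>N\<close> only on classical terms.
\<close>

abbreviation (input) zero_subst :: "'x \<Rightarrow> ('a, 'c, 'f, 'x) trm" where
  "zero_subst \<equiv> (\<lambda>_. App (Constr CZero) [])"

function coef ::
  "('a, 'c, 'f, 'x) signat \<Rightarrow> ('a, 'c, 'f, 'x) trm \<Rightarrow> ('a, 'c, 'f, 'x) trm \<Rightarrow> complex" where
  "coef \<Sigma> (Var x) u = (if u = Var x then 1 else 0)"
| "coef \<Sigma> (App b ts) u = (case u of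
     App b' us \<Rightarrow> if b' = b \<and> length us = length ts
       then prod_list (map (\<lambda>(t, v). coef \<Sigma> t v) (zip ts us)) else 0
   | _ \<Rightarrow> 0)"
| "coef \<Sigma> (Scal \<alpha> t) u = amp_sem \<Sigma> (amp_subst zero_subst \<alpha>) * coef \<Sigma> t u"
| "coef \<Sigma> (Plus s t) u = coef \<Sigma> s u + coef \<Sigma> t u"
  by pat_completeness auto
termination
  by (relation "measure (\<lambda>(_, t, _). size t)")
    (auto dest!: set_zip_leftD simp: less_Suc_eq_le intro!: add_increasing size_list_estimation'[OF _ order_refl])

lemma prod_list_eq_0_coef:
  assumes "length us = length ts" and "us \<noteq> ts"
    and "\<And>t u. t \<in> set ts \<Longrightarrow> coef \<Sigma> t u = (if u = t then 1 else 0)"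
  shows "prod_list (map (\<lambda>(t, v). coef \<Sigma> t v) (zip ts us)) = 0"
  using assms
proof (induction ts arbitrary: us)
  case (Cons t ts)
  then show ?case by (cases us) auto
qed simp

lemma prod_list_eq_1_coef:
  assumes "\<And>t u. t \<in> set ts \<Longrightarrow> coef \<Sigma> t u = (if u = t then 1 else 0)"
  shows "prod_list (map (\<lambda>(t, v). coef \<Sigma> t v) (zip ts ts)) = 1"
  using assms by (induction ts) auto

lemma coef_classical: "classical t \<Longrightarrow> coef \<Sigma> t u = (if u = t then 1 else 0)"
proof (induction t arbitrary: u rule: classical.induct)
  case (2 b ts)
  have *: "\<And>t u. t \<in> set ts \<Longrightarrow> coef \<Sigma> t u = (if u = t then 1 else 0)"
    using 2 by simp
  show ?case
  proof (cases u)
    case (App b' us)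
    show ?thesis
    proof (cases "b' = b \<and> length us = length ts")
      case True
      show ?thesis
      proof (cases "us = ts")
        case True
        then show ?thesis using prod_list_eq_1_coef[of ts \<Sigma>] * App by simp
      next
        case False
        then show ?thesis
          using prod_list_eq_0_coef[of us ts \<Sigma>] * App \<open>b' = b \<and> length us = length ts\<close> by simp
      qed
    qed (use App in auto)
  qed auto
qed auto

lemma coef_App_factor:
  "\<exists>K j. \<forall>s. coef \<Sigma> (App b (ts @ s # us)) u = K * coef \<Sigma> s j"
proof (cases u)
  case (App b' vs)
  show ?thesis
  proof (cases "b' = b \<and> length vs = length ts + Suc (length us)")
    case True
    have eq: "vs = take (length ts) vs @ vs ! length ts # drop (Suc (length ts)) vs"
      using True by (simp add: id_take_nth_drop)
    have len: "length ts = length (take (length ts) vs)"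
      using True by simp
    define vs1 v vs2 where "vs1 = take (length ts) vs" and "v = vs ! length ts"
      and "vs2 = drop (Suc (length ts)) vs"
    have vs: "vs = vs1 @ v # vs2" and l: "length ts = length vs1"
      using eq len by (auto simp: vs1_def v_def vs2_def)
    have "coef \<Sigma> (App b (ts @ s # us)) u =
        prod_list (map (\<lambda>(t, v). coef \<Sigma> t v) (zip ts vs1)) *
        prod_list (map (\<lambda>(t, v). coef \<Sigma> t v) (zip us vs2)) * coef \<Sigma> s v" for s
      using App True l by (simp add: vs)
    then show ?thesis by blast
  next
    case False
    then show ?thesis using App by (intro exI[of _ 0]) auto
  qed
qed (auto intro: exI[of _ 0])

lemma is_subst_zero: "is_subst \<Sigma> zero_subst"
  by (simp add: is_subst_def symbs_def)

lemma is_nat_zero_subst: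
  "is_nat_trm \<Sigma> t \<Longrightarrow> is_nat_trm \<Sigma> (subst zero_subst t) \<and> vars (subst zero_subst t) = {}"
  by (induction \<Sigma> t rule: is_nat_trm.induct) auto

lemma wf_amp_zero_subst:
  "wf_amp \<Sigma> \<alpha> \<Longrightarrow>
     wf_amp \<Sigma> (amp_subst zero_subst \<alpha>) \<and> amp_vars (amp_subst zero_subst \<alpha>) = {}"
  by (induction \<Sigma> \<alpha> rule: wf_amp.induct) (auto dest: is_nat_zero_subst)

lemma amp_denotes_zero_subst:
  "amp_denotes \<Sigma> \<alpha> z \<Longrightarrow> wf_amp \<Sigma> \<alpha> \<Longrightarrow> amp_sem \<Sigma> (amp_subst zero_subst \<alpha>) = z"
  using is_subst_zero[of \<Sigma>] wf_amp_zero_subst[of \<Sigma> \<alpha>] unfolding amp_denotes_def by blast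

lemma is_nat_ground_subst: "is_nat_trm \<Sigma> t \<Longrightarrow> vars t = {} \<Longrightarrow> subst \<sigma> t = t"
  by (induction \<Sigma> t rule: is_nat_trm.induct) auto

lemma wf_amp_ground_subst: "wf_amp \<Sigma> \<alpha> \<Longrightarrow> amp_vars \<alpha> = {} \<Longrightarrow> amp_subst \<sigma> \<alpha> = \<alpha>"
  by (induction \<Sigma> \<alpha> rule: wf_amp.induct) (auto intro!: map_idI dest: is_nat_ground_subst)

lemma amp_denotes_ground:
  "wf_amp \<Sigma> \<alpha> \<Longrightarrow> amp_vars \<alpha> = {} \<Longrightarrow> amp_denotes \<Sigma> \<alpha> z \<longleftrightarrow> amp_sem \<Sigma> \<alpha> = z"
  using is_subst_zero[of \<Sigma>] wf_amp_ground_subst[of \<Sigma> \<alpha>] unfolding amp_denotes_def by auto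

lemma teq_coef: "teq \<Sigma> s t \<Longrightarrow> coef \<Sigma> s u = coef \<Sigma> t u"
proof (induction arbitrary: u rule: teq.induct)
  case (teq_ctx_app s t b ts us)
  obtain K j where "\<forall>s. coef \<Sigma> (App b (ts @ s # us)) u = K * coef \<Sigma> s j"
    using coef_App_factor by blast
  then show ?case using teq_ctx_app by metis
next
  case (teq_app_scal b ts \<alpha> t us)
  obtain K j where *: "\<forall>s. coef \<Sigma> (App b (ts @ s # us)) u = K * coef \<Sigma> s j"
    using coef_App_factor by blast
  show ?case unfolding coef.simps(3) *[rule_format] by simp
next
  case (teq_app_plus b ts s t us)
  obtain K j where *: "\<forall>s. coef \<Sigma> (App b (ts @ s # us)) u = K * coef \<Sigma> s j"
    using coef_App_factor by blast
  show ?case unfolding coef.simps(4) *[rule_format] by (simp add: algebra_simps)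
qed (auto simp: algebra_simps amp_denotes_zero_subst simp del: coef.simps(2))

lemma coef_lsum:
  "ps \<noteq> [] \<Longrightarrow>
     coef \<Sigma> (lsum ps) u = (\<Sum>(\<alpha>, t)\<leftarrow>ps. amp_sem \<Sigma> (amp_subst zero_subst \<alpha>) * coef \<Sigma> t u)"
  by (induction ps rule: lsum.induct) auto

lemma lsum_ground:
  "lsum ps \<in> ground_trms \<Sigma> \<Longrightarrow> ps \<noteq> [] \<Longrightarrow> (\<alpha>, t) \<in> set ps \<Longrightarrow>
     amp_vars \<alpha> = {} \<and> t \<in> ground_trms \<Sigma>"
  by (induction ps rule: lsum.induct) (auto simp: ground_trms_def)

lemma coef_lsum_canonical:
  assumes "canonical \<Sigma> ps" and "lsum ps \<in> ground_trms \<Sigma>" and "(\<alpha>, t) \<in> set ps"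
  shows "coef \<Sigma> (lsum ps) t \<noteq> 0"
proof -
  have ne: "ps \<noteq> []" and d: "distinct (map snd ps)"
    and c: "\<And>\<beta> s. (\<beta>, s) \<in> set ps \<Longrightarrow> classical s"
    using assms(1) by (auto simp: canonical_def classical_trms_def)
  have "(\<Sum>(\<beta>, s)\<leftarrow>ps. amp_sem \<Sigma> (amp_subst zero_subst \<beta>) * coef \<Sigma> s t) =
      amp_sem \<Sigma> (amp_subst zero_subst \<alpha>)"
    using d c assms(3)
  proof (induction ps)
    case (Cons p ps)
    obtain \<beta> s where p: "p = (\<beta>, s)" by force
    show ?case
    proof (cases "s = t")
      case True
      then have "p = (\<alpha>, t)" using Cons.prems p by force
      moreover have "(\<Sum>(\<beta>, s)\<leftarrow>ps. amp_sem \<Sigma> (amp_subst zero_subst \<beta>) * coef \<Sigma> s t) = 0"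
      proof -
        have "map (\<lambda>(\<beta>, s). amp_sem \<Sigma> (amp_subst zero_subst \<beta>) * coef \<Sigma> s t) ps =
            map (\<lambda>_. 0) ps"
        proof (rule map_cong[OF refl], clarify)
          fix \<gamma> s' assume in_ps: "(\<gamma>, s') \<in> set ps"
          then have "s' \<noteq> t" using Cons.prems(1) p True by force
          moreover have "classical s'" using Cons.prems(2) in_ps by force
          ultimately show "amp_sem \<Sigma> (amp_subst zero_subst \<gamma>) * coef \<Sigma> s' t = 0"
            by (simp add: coef_classical)
        qed
        then show ?thesis by (simp only: sum_list_0)
      qed
      ultimately show ?thesis using Cons.prems(2)[of \<alpha> t] by (simp add: coef_classical)
    next
      case False
      then have "(\<alpha>, t) \<in> set ps" using Cons.prems p by auto
      then have "(\<Sum>(\<beta>, s)\<leftarrow>ps. amp_sem \<Sigma> (amp_subst zero_subst \<beta>) * coef \<Sigma> s t) =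
          amp_sem \<Sigma> (amp_subst zero_subst \<alpha>)"
        using Cons by auto
      then show ?thesis using False p Cons.prems(2)[of \<beta> s] by (simp add: coef_classical)
    qed
  qed simp
  moreover have "amp_sem \<Sigma> (amp_subst zero_subst \<alpha>) \<noteq> 0"
  proof -
    have "wf_amp \<Sigma> \<alpha>" "\<not> amp_denotes \<Sigma> \<alpha> 0"
      using assms(1,3) by (auto simp: canonical_def)
    moreover have "amp_vars \<alpha> = {}" using lsum_ground assms(2,3) ne by blast
    ultimately show ?thesis by (simp add: amp_denotes_ground wf_amp_ground_subst)
  qed
  ultimately show ?thesis using coef_lsum[OF ne] by simp
qed

definition C_reducible ::
  "('a, 'c, 'f, 'x) signat \<Rightarrow> ('a, 'c, 'f, 'x) rule set \<Rightarrow> ('a, 'c, 'f, 'x) trm \<Rightarrow> bool" where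
  "C_reducible \<Sigma> \<R> s \<longleftrightarrow>
     (\<exists>l r \<sigma> E. s = plug E (subst \<sigma> l) \<and> (l, r) \<in> \<R> \<and> is_subst \<Sigma> \<sigma> \<and> is_ectx E \<and>
        classical s \<and> s \<in> ground_trms \<Sigma> \<and> plug E (subst \<sigma> r) \<in> ground_trms \<Sigma>)"

lemma red_wrt_coef: "red_wrt \<Sigma> \<R> N s t \<Longrightarrow> \<exists>u. C_reducible \<Sigma> \<R> u \<and> coef \<Sigma> s u \<noteq> 0"
proof (induction rule: red_wrt.induct)
  case (red_C l r \<sigma> E)
  then have "C_reducible \<Sigma> \<R> (plug E (subst \<sigma> l))" unfolding C_reducible_def by blast
  then show ?case using red_C by (auto simp: coef_classical)
next
  case (red_E s t s' t')
  then show ?case by (metis teq_coef)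
next
  case (red_Q ps)
  let ?qs = "map (\<lambda>(\<alpha>, s, t). (\<alpha>, s)) ps"
  obtain \<alpha> s t where in_ps: "(\<alpha>, s, t) \<in> set ps"
    and ex: "\<exists>u. C_reducible \<Sigma> \<R> u \<and> coef \<Sigma> s u \<noteq> 0"
    using red_Q(4) by auto
  have in_qs: "(\<alpha>, s) \<in> set ?qs" using in_ps by force
  have "classical s"
    using red_Q(1) in_qs unfolding canonical_def classical_trms_def by blast
  then have "C_reducible \<Sigma> \<R> s" using ex by (metis coef_classical)
  then show ?case using coef_lsum_canonical[OF red_Q(1,2) in_qs] by blast
qed

lemma red_wrt_classical_iff:
  "classical s \<Longrightarrow> (\<exists>t. red_wrt \<Sigma> \<R> N s t) \<longleftrightarrow> C_reducible \<Sigma> \<R> s"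
proof
  assume "classical s" and "\<exists>t. red_wrt \<Sigma> \<R> N s t"
  then show "C_reducible \<Sigma> \<R> s" by (metis coef_classical red_wrt_coef)
next
  assume "C_reducible \<Sigma> \<R> s"
  then show "\<exists>t. red_wrt \<Sigma> \<R> N s t"
    unfolding C_reducible_def by (blast intro: red_wrt.red_C)
qed

lemma red_wrt_mono:
  assumes "red_wrt \<Sigma> \<R> N s t" and "N \<inter> Collect classical \<subseteq> N'"
  shows "red_wrt \<Sigma> \<R> N' s t"
  using assms(1)
proof (induction rule: red_wrt.induct)
  case (red_Q ps)
  have "\<forall>(\<alpha>, s, t)\<in>set ps. classical s"
    using red_Q(1) by (fastforce simp: canonical_def classical_trms_def)
  then have "\<forall>(\<alpha>, s, t)\<in>set ps. s \<in> N' \<and> t = s \<or> red_wrt \<Sigma> \<R> N' s t"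
    using red_Q(3) assms(2) by fastforce
  moreover have "\<exists>(\<alpha>, s, t)\<in>set ps. red_wrt \<Sigma> \<R> N' s t"
    using red_Q(4) by fastforce
  ultimately show ?case using red_Q(1,2) by (intro red_wrt.red_Q)
qed (auto intro: red_wrt.intros)

lemma red_wrt_NF_eq:
  "red_wrt \<Sigma> \<R> (NF_of \<Sigma> (red_wrt \<Sigma> \<R> N)) = red_wrt \<Sigma> \<R> (NF_of \<Sigma> (red_wrt \<Sigma> \<R> N'))"
proof -
  have *: "NF_of \<Sigma> (red_wrt \<Sigma> \<R> M) \<inter> Collect classical \<subseteq> NF_of \<Sigma> (red_wrt \<Sigma> \<R> M')" for M M'
    unfolding NF_of_def using red_wrt_classical_iff by blast
  show ?thesis by (intro ext iffI) (erule red_wrt_mono[OF _ *])+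
qed

lemma red_unique: "\<exists>!rel. rel = red_wrt \<Sigma> \<R> (NF_of \<Sigma> rel)"
proof (rule ex1I)
  let ?rel = "red_wrt \<Sigma> \<R> (NF_of \<Sigma> (red_wrt \<Sigma> \<R> {}))"
  show "?rel = red_wrt \<Sigma> \<R> (NF_of \<Sigma> ?rel)"
    by (rule red_wrt_NF_eq)
  fix rel assume "rel = red_wrt \<Sigma> \<R> (NF_of \<Sigma> rel)"
  then show "rel = ?rel" by (metis red_wrt_NF_eq)
qed

lemma red_unfold: "red \<Sigma> \<R> = red_wrt \<Sigma> \<R> (NF \<Sigma> \<R>)"
  unfolding NF_def red_def by (rule theI'[OF red_unique])


section \<open>Orders\<close>

definition strict_of :: "('t \<times> 't) set \<Rightarrow> ('t \<times> 't) set" where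
  "strict_of r = {(s, t). (s, t) \<in> r \<and> (t, s) \<notin> r}"

definition no_infinite_chain :: "('t \<times> 't) set \<Rightarrow> bool" where
  "no_infinite_chain r \<longleftrightarrow> (\<nexists>ch :: nat \<Rightarrow> 't. \<forall>i. (ch i, ch (Suc i)) \<in> r)"

definition monotonic ::
  "('a, 'c, 'f, 'x) signat \<Rightarrow> (('a, 'c, 'f, 'x) trm \<times> ('a, 'c, 'f, 'x) trm) set \<Rightarrow> bool" where
  "monotonic \<Sigma> gt \<longleftrightarrow>
     (\<forall>b ts s t us. (s, t) \<in> gt \<longrightarrow> App b (ts @ s # us) \<in> classical_trms \<Sigma> \<longrightarrow>
        (App b (ts @ s # us), App b (ts @ t # us)) \<in> gt)"

definition subst_closed ::
  "('a, 'c, 'f, 'x) signat \<Rightarrow> (('a, 'c, 'f, 'x) trm \<times> ('a, 'c, 'f, 'x) trm) set \<Rightarrow> bool" where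
  "subst_closed \<Sigma> gt \<longleftrightarrow>
     (\<forall>s t \<sigma>. (s, t) \<in> gt \<longrightarrow> is_subst \<Sigma> \<sigma> \<longrightarrow> (\<forall>x\<in>sg_vars \<Sigma>. classical (\<sigma> x)) \<longrightarrow>
        (subst \<sigma> s, subst \<sigma> t) \<in> gt)"

definition rewrite_order ::
  "('a, 'c, 'f, 'x) signat \<Rightarrow> (('a, 'c, 'f, 'x) trm \<times> ('a, 'c, 'f, 'x) trm) set \<Rightarrow> bool" where
  "rewrite_order \<Sigma> gt \<longleftrightarrow> monotonic \<Sigma> gt \<and> subst_closed \<Sigma> gt"

definition compatible ::
  "('a, 'c, 'f, 'x) rule set \<Rightarrow> (('a, 'c, 'f, 'x) trm \<times> ('a, 'c, 'f, 'x) trm) set \<Rightarrow> bool" where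
  "compatible \<R> gt \<longleftrightarrow> (\<forall>(l, r)\<in>\<R>. (l, r) \<in> gt)"

inductive_set worst_path ::
  "('a, 'c, 'f, 'x) signat \<Rightarrow> (('a, 'c, 'f, 'x) trm \<times> ('a, 'c, 'f, 'x) trm) set \<Rightarrow>
    (('a, 'c, 'f, 'x) trm \<times> ('a, 'c, 'f, 'x) trm) set"
  for \<Sigma> :: "('a, 'c, 'f, 'x) signat"
    and geq :: "(('a, 'c, 'f, 'x) trm \<times> ('a, 'c, 'f, 'x) trm) set" where
  wp_classical: "s \<in> classical_trms \<Sigma> \<Longrightarrow> t \<in> classical_trms \<Sigma> \<Longrightarrow> (s, t) \<in> geq \<Longrightarrow>
    (s, t) \<in> worst_path \<Sigma> geq"
| wp_left: "teq \<Sigma> s (lsum ps) \<Longrightarrow> canonical \<Sigma> ps \<Longrightarrow> \<exists>(\<alpha>, s')\<in>set ps. (s', t) \<in> worst_path \<Sigma> geq \<Longrightarrow>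
    (s, t) \<in> worst_path \<Sigma> geq"
| wp_right: "teq \<Sigma> t (lsum ps) \<Longrightarrow> canonical \<Sigma> ps \<Longrightarrow> \<forall>(\<alpha>, t')\<in>set ps. (s, t') \<in> worst_path \<Sigma> geq \<Longrightarrow>
    (s, t) \<in> worst_path \<Sigma> geq"

end

(* Every term denotes a finite linear combination of classical terms, invariant under equivalence for
   every assignment of naturals to the variables of its amplitudes; the support of the term collects
   the classical terms that have a non-zero coefficient for some assignment. A strict worst-path step
   from the classical left-hand side l to r says that l is strictly greater than each element of the
   support of r, and this survives substitution and classical contexts, even though distinct summands
   may then coincide and cancel. So each element of the support of the reduct of a classical term is
   smaller than that term. By orthogonality a classical term has at most one reduct, hence this
   relation is finitely branching and well-founded, so it has a height function with values in the
   naturals. Rule (Q) reduces all reducible elements of the support at once; therefore the maximal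
   height of those elements decreases in every step and bounds the length of all chains. *)

theory Submission
  imports Defs
begin

section \<open>The expansion of a term into classical terms\<close>

text \<open>\<open>lin A t \<phi>\<close> is the linear extension of \<phi> applied to the
  combination of classical terms denoted by \<open>t\<close>, with amplitudes valued by
  \<open>A\<close>; argument lists expand multilinearly. Passing \<phi> as a continuation makes each
  axiom of the equivalence an algebraic identity. The coefficient of \<open>u\<close> is obtained by
  taking the indicator of \<open>u\<close> for \<phi>.\<close>

fun lin :: "(('a, 'c, 'f, 'x) amp \<Rightarrow> complex) \<Rightarrow> ('a, 'c, 'f, 'x) trm \<Rightarrow>
    (('a, 'c, 'f, 'x) trm \<Rightarrow> complex) \<Rightarrow> complex"
  and lins :: "(('a, 'c, 'f, 'x) amp \<Rightarrow> complex) \<Rightarrow> ('a, 'c, 'f, 'x) trm list \<Rightarrow>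
    (('a, 'c, 'f, 'x) trm list \<Rightarrow> complex) \<Rightarrow> complex" where
  "lin A (Var x) = (\<lambda>\<phi>. \<phi> (Var x))"
| "lin A (App b ts) = (\<lambda>\<phi>. lins A ts (\<lambda>vs. \<phi> (App b vs)))"
| "lin A (Scal \<alpha> t) = (\<lambda>\<phi>. A \<alpha> * lin A t \<phi>)"
| "lin A (Plus s t) = (\<lambda>\<phi>. lin A s \<phi> + lin A t \<phi>)"
| "lins A [] = (\<lambda>\<psi>. \<psi> [])"
| "lins A (t # ts) = (\<lambda>\<psi>. lin A t (\<lambda>v. lins A ts (\<lambda>vs. \<psi> (v # vs))))"

text \<open>A finite superset of the terms with non-zero coefficient: coefficients, and hence
  cancellations, are ignored.\<close>

fun summands :: "('a, 'c, 'f, 'x) trm \<Rightarrow> ('a, 'c, 'f, 'x) trm set"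
  and summands_list :: "('a, 'c, 'f, 'x) trm list \<Rightarrow> ('a, 'c, 'f, 'x) trm list set" where
  "summands (Var x) = {Var x}"
| "summands (App b ts) = App b ` summands_list ts"
| "summands (Scal \<alpha> t) = summands t"
| "summands (Plus s t) = summands s \<union> summands t"
| "summands_list [] = {[]}"
| "summands_list (t # ts) = case_prod Cons ` (summands t \<times> summands_list ts)"

section \<open>Linearity and coefficients\<close>

lemma lin_add:
  "lin A t (\<lambda>v. \<phi> v + \<phi>' v) = lin A t \<phi> + lin A t \<phi>'"
  "lins A ts (\<lambda>vs. \<psi> vs + \<psi>' vs) = lins A ts \<psi> + lins A ts \<psi>'"
  by (induction A t and A ts arbitrary: \<phi> \<phi>' and \<psi> \<psi>' rule: lin_lins.induct)
    (simp_all add: algebra_simps)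

lemma lin_cmult:
  "lin A t (\<lambda>v. c * \<phi> v) = c * lin A t \<phi>"
  "lins A ts (\<lambda>vs. c * \<psi> vs) = c * lins A ts \<psi>"
  by (induction A t and A ts arbitrary: \<phi> and \<psi> rule: lin_lins.induct)
    (simp_all add: distrib_left)

lemma lin_sum: "finite S \<Longrightarrow> lin A t (\<lambda>v. \<Sum>u\<in>S. \<phi> u v) = (\<Sum>u\<in>S. lin A t (\<phi> u))"
proof (induction S rule: finite_induct)
  case empty
  then show ?case using lin_cmult(1)[of A t 0] by simp
qed (simp add: lin_add)

lemma lin_cong:
  "(\<And>v. v \<in> summands t \<Longrightarrow> \<phi> v = \<phi>' v) \<Longrightarrow> lin A t \<phi> = lin A t \<phi>'"
  "(\<And>vs. vs \<in> summands_list ts \<Longrightarrow> \<psi> vs = \<psi>' vs) \<Longrightarrow> lins A ts \<psi> = lins A ts \<psi>'"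
proof (induction A t and A ts arbitrary: \<phi> \<phi>' and \<psi> \<psi>' rule: lin_lins.induct)
  case (2 A b ts)
  have "lins A ts (\<lambda>vs. \<phi> (App b vs)) = lins A ts (\<lambda>vs. \<phi>' (App b vs))"
    by (rule 2(1)) (simp add: 2(2))
  then show ?case by simp
next
  case (3 A \<alpha> t)
  have "lin A t \<phi> = lin A t \<phi>'" by (rule 3(1)) (simp add: 3(2))
  then show ?case by simp
next
  case (4 A s t)
  have "lin A s \<phi> = lin A s \<phi>'" by (rule 4(1)) (simp add: 4(3))
  moreover have "lin A t \<phi> = lin A t \<phi>'" by (rule 4(2)) (simp add: 4(3))
  ultimately show ?case by simp
next
  case (6 A t ts)
  have "lin A t (\<lambda>v. lins A ts (\<lambda>vs. \<psi> (v # vs))) = lin A t (\<lambda>v. lins A ts (\<lambda>vs. \<psi>' (v # vs)))"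
    by (rule 6(1), rule 6(2)) (auto intro!: 6(3))
  then show ?case by simp
qed simp_all

lemma finite_summands:
  fixes t :: "('a, 'c, 'f, 'x) trm" and ts :: "('a, 'c, 'f, 'x) trm list"
  shows "finite (summands t)" and "finite (summands_list ts)"
  by (induction t and ts rule: summands_summands_list.induct) auto

text \<open>On the finite set of summands, \<phi> is a combination of indicators, so linearity
  reduces everything to coefficients.\<close>

lemma lin_expand:
  "lin A t \<phi> = (\<Sum>u\<in>summands t. lin A t (\<lambda>v. of_bool (v = u)) * \<phi> u)"
proof -
  have "lin A t \<phi> = lin A t (\<lambda>v. \<Sum>u\<in>summands t. \<phi> u * of_bool (v = u))"
    by (rule lin_cong) (simp add: finite_summands of_bool_def if_distrib cong: if_cong)
  also have "\<dots> = (\<Sum>u\<in>summands t. lin A t (\<lambda>v. of_bool (v = u)) * \<phi> u)"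
    unfolding lin_sum[OF finite_summands(1)] lin_cmult by (simp add: mult.commute)
  finally show ?thesis .
qed

lemma lin_eq_0_outside: "u \<notin> summands t \<Longrightarrow> lin A t (\<lambda>v. of_bool (v = u)) = 0"
  by (subst lin_expand) (auto intro!: sum.neutral)

lemma lin_classical:
  "classical t \<Longrightarrow> lin A t \<phi> = \<phi> t"
  "(\<forall>t\<in>set ts. classical t) \<Longrightarrow> lins A ts \<psi> = \<psi> ts"
  by (induction A t and A ts arbitrary: \<phi> and \<psi> rule: lin_lins.induct) auto

lemma lins_append: "lins A (ts @ us) \<psi> = lins A ts (\<lambda>vs. lins A us (\<lambda>ws. \<psi> (vs @ ws)))"
  by (induction ts arbitrary: \<psi>) simp_all

lemma lin_lsum: "ps \<noteq> [] \<Longrightarrow> lin A (lsum ps) \<phi> = (\<Sum>(\<alpha>, t)\<leftarrow>ps. A \<alpha> * lin A t \<phi>)"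
  by (induction ps rule: lsum.induct) auto

text \<open>Reads off one coefficient of a canonical form: by distinctness, no second entry carries
  the term \<open>t\<close>.\<close>

lemma sum_list_distinct_snd:
  fixes g :: "'p \<Rightarrow> 'q \<Rightarrow> complex"
  assumes "distinct (map snd ps)" and "(\<alpha>, t) \<in> set ps"
    and "\<And>\<beta> s. (\<beta>, s) \<in> set ps \<Longrightarrow> s \<noteq> t \<Longrightarrow> g \<beta> s = 0"
  shows "(\<Sum>(\<beta>, s)\<leftarrow>ps. g \<beta> s) = g \<alpha> t"
proof -
  have "distinct ps" using assms(1) by (simp add: distinct_map)
  then have "(\<Sum>(\<beta>, s)\<leftarrow>ps. g \<beta> s) = (\<Sum>(\<beta>, s)\<in>set ps. g \<beta> s)"
    by (simp add: sum_list_distinct_conv_sum_set)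
  also have "\<dots> = (\<Sum>(\<beta>, s)\<in>{(\<alpha>, t)}. g \<beta> s)"
  proof (rule sum.mono_neutral_right)
    have "s \<noteq> t" if "(\<beta>, s) \<in> set ps" "(\<beta>, s) \<noteq> (\<alpha>, t)" for \<beta> s
      using inj_onD[of snd "set ps" "(\<beta>, s)" "(\<alpha>, t)"] assms(1,2) that by (auto simp: distinct_map)
    then show "\<forall>p\<in>set ps - {(\<alpha>, t)}. (case p of (\<beta>, s) \<Rightarrow> g \<beta> s) = 0"
      using assms(3) by auto
  qed (use assms(2) in auto)
  finally show ?thesis by simp
qed


section \<open>Assignments of naturals to the variables of amplitudes\<close>

text \<open>All variables are covered, including those outside the signature, so that every
  well-formed amplitude becomes ground and well-formed under \<open>\<rho>\<close>.\<close>

definition nat_assign ::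
  "('a, 'c, 'f, 'x) signat \<Rightarrow> ('x \<Rightarrow> ('a, 'c, 'f, 'x) trm) \<Rightarrow> bool" where
  "nat_assign \<Sigma> \<rho> \<longleftrightarrow> (\<forall>x. is_nat_trm \<Sigma> (\<rho> x) \<and> vars (\<rho> x) = {})"

abbreviation amp_val ::
  "('a, 'c, 'f, 'x) signat \<Rightarrow> ('x \<Rightarrow> ('a, 'c, 'f, 'x) trm) \<Rightarrow> ('a, 'c, 'f, 'x) amp \<Rightarrow> complex" where
  "amp_val \<Sigma> \<rho> \<alpha> \<equiv> amp_sem \<Sigma> (amp_subst \<rho> \<alpha>)"

lemma ground_nat_value: "is_nat_trm \<Sigma> t \<Longrightarrow> vars t = {} \<Longrightarrow> wf_trm \<Sigma> t \<and> is_value t"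
  by (induction \<Sigma> t rule: is_nat_trm.induct) (auto simp: symbs_def)

lemma nat_assign_is_subst: "nat_assign \<Sigma> \<rho> \<Longrightarrow> is_subst \<Sigma> \<rho>"
  unfolding nat_assign_def is_subst_def using ground_nat_value by blast

lemma is_nat_subst:
  "nat_assign \<Sigma> \<rho> \<Longrightarrow> is_nat_trm \<Sigma> t \<Longrightarrow>
     is_nat_trm \<Sigma> (subst \<rho> t) \<and> vars (subst \<rho> t) = {}"
  by (induction \<Sigma> t rule: is_nat_trm.induct) (auto simp: nat_assign_def)

lemma wf_amp_nat_subst:
  "nat_assign \<Sigma> \<rho> \<Longrightarrow> wf_amp \<Sigma> \<alpha> \<Longrightarrow>
     wf_amp \<Sigma> (amp_subst \<rho> \<alpha>) \<and> amp_vars (amp_subst \<rho> \<alpha>) = {}"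
  by (induction \<Sigma> \<alpha> rule: wf_amp.induct) (auto dest: is_nat_subst)

lemma amp_denotes_val:
  "amp_denotes \<Sigma> \<alpha> z \<Longrightarrow> wf_amp \<Sigma> \<alpha> \<Longrightarrow> nat_assign \<Sigma> \<rho> \<Longrightarrow> amp_val \<Sigma> \<rho> \<alpha> = z"
  unfolding amp_denotes_def using nat_assign_is_subst wf_amp_nat_subst by blast

section \<open>Substitutions and variables\<close>

lemma subst_cong:
  "(\<And>x. x \<in> vars t \<Longrightarrow> \<sigma> x = \<tau> x) \<Longrightarrow> subst \<sigma> t = subst \<tau> t"
  "(\<And>x. x \<in> amp_vars \<alpha> \<Longrightarrow> \<sigma> x = \<tau> x) \<Longrightarrow> amp_subst \<sigma> \<alpha> = amp_subst \<tau> \<alpha>"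
  by (induction t and \<alpha>) auto

lemma subst_subst:
  "subst \<tau> (subst \<sigma> t) = subst (\<lambda>x. subst \<tau> (\<sigma> x)) t"
  "amp_subst \<tau> (amp_subst \<sigma> \<alpha>) = amp_subst (\<lambda>x. subst \<tau> (\<sigma> x)) \<alpha>"
  by (induction t and \<alpha>) auto

lemma vars_subst:
  "vars (subst \<sigma> t) = (\<Union>x\<in>vars t. vars (\<sigma> x))"
  "amp_vars (amp_subst \<sigma> \<alpha>) = (\<Union>x\<in>amp_vars \<alpha>. vars (\<sigma> x))"
  by (induction t and \<alpha>) auto

lemma is_nat_subst_vars: "is_nat_trm \<Sigma> (subst \<sigma> t) \<Longrightarrow> x \<in> vars t \<Longrightarrow> is_nat_trm \<Sigma> (\<sigma> x)"
proof (induction t)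
  case (App b ts)
  then show ?case by (cases "(\<Sigma>, subst \<sigma> (App b ts))" rule: is_nat_trm.cases) auto
qed auto

lemma wf_amp_subst_vars: "wf_amp \<Sigma> (amp_subst \<sigma> \<alpha>) \<Longrightarrow> x \<in> amp_vars \<alpha> \<Longrightarrow> is_nat_trm \<Sigma> (\<sigma> x)"
proof (induction \<Sigma> \<alpha> rule: wf_amp.induct)
  case (1 \<Sigma> a ts)
  then show ?case using is_nat_subst_vars by fastforce
qed auto

text \<open>A substitution refuting \<open>amp_denotes\<close> already gives naturals to the
  variables of \<alpha>, since the instance is well-formed and ground. Resetting the others to 0
  leaves the instance unchanged.\<close>

lemma not_denotes_0:
  assumes "\<not> amp_denotes \<Sigma> \<alpha> 0"
  shows "\<exists>\<rho>. nat_assign \<Sigma> \<rho> \<and> amp_val \<Sigma> \<rho> \<alpha> \<noteq> 0"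
proof -
  obtain \<sigma> where \<sigma>: "wf_amp \<Sigma> (amp_subst \<sigma> \<alpha>)" "amp_vars (amp_subst \<sigma> \<alpha>) = {}"
    "amp_sem \<Sigma> (amp_subst \<sigma> \<alpha>) \<noteq> 0"
    using assms unfolding amp_denotes_def by blast
  define \<rho> where "\<rho> = (\<lambda>x. if x \<in> amp_vars \<alpha> then \<sigma> x else App (Constr CZero) [])"
  have "nat_assign \<Sigma> \<rho>"
    using \<sigma> wf_amp_subst_vars[of \<Sigma> \<sigma> \<alpha>] by (auto simp: nat_assign_def \<rho>_def vars_subst)
  moreover have "amp_subst \<rho> \<alpha> = amp_subst \<sigma> \<alpha>"
    by (rule subst_cong) (simp add: \<rho>_def)
  ultimately show ?thesis using \<sigma>(3) by auto
qed

text \<open>The axioms are instances of multilinearity; those about coefficients 0 and 1 apply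
  because an assignment is one of the substitutions over which \<open>amp_denotes\<close>
  quantifies.\<close>

lemma teq_lin: "teq \<Sigma> s t \<Longrightarrow> nat_assign \<Sigma> \<rho> \<Longrightarrow> lin (amp_val \<Sigma> \<rho>) s \<phi> = lin (amp_val \<Sigma> \<rho>) t \<phi>"
  by (induction arbitrary: \<phi> rule: teq.induct)
    (simp_all add: lins_append lin_add lin_cmult amp_denotes_val distrib_left distrib_right add.commute)


section \<open>Supports\<close>

text \<open>Right-hand sides of rules may have variables in amplitudes. As in
  \<open>canonical\<close>, a coefficient counts as non-zero if it is so for some
  assignment.\<close>

definition support ::
  "('a, 'c, 'f, 'x) signat \<Rightarrow> ('a, 'c, 'f, 'x) trm \<Rightarrow> ('a, 'c, 'f, 'x) trm set" where
  "support \<Sigma> t =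
     {u. \<exists>\<rho>. nat_assign \<Sigma> \<rho> \<and> lin (amp_val \<Sigma> \<rho>) t (\<lambda>v. of_bool (v = u)) \<noteq> 0}"

lemma nat_assign_ex: "nat_assign \<Sigma> (\<lambda>_. App (Constr CZero) [])"
  by (simp add: nat_assign_def)

lemma finite_support: "finite (support \<Sigma> t)"
  by (rule finite_subset[OF _ finite_summands(1)[of t]])
    (use lin_eq_0_outside in \<open>auto simp: support_def\<close>)

lemma support_classical: "classical t \<Longrightarrow> support \<Sigma> t = {t}"
  using nat_assign_ex by (fastforce simp: support_def lin_classical)

lemma teq_support: "teq \<Sigma> s t \<Longrightarrow> support \<Sigma> s = support \<Sigma> t"
  by (auto simp: support_def teq_lin)

text \<open>Pulls support elements back along a map \<open>g\<close>: with the indicator of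
  \<open>w\<close> composed with \<open>g\<close> for \<phi>, it yields a preimage of
  \<open>w\<close>. Images may merge and cancel, so only this direction is available.\<close>

lemma lin_nonzero_support:
  assumes "nat_assign \<Sigma> \<rho>" and "lin (amp_val \<Sigma> \<rho>) t \<phi> \<noteq> 0"
  shows "\<exists>u\<in>support \<Sigma> t. \<phi> u \<noteq> 0"
proof -
  have "\<exists>u\<in>summands t. lin (amp_val \<Sigma> \<rho>) t (\<lambda>v. of_bool (v = u)) * \<phi> u \<noteq> 0"
  proof (rule ccontr)
    assume "\<not> ?thesis"
    then have "lin (amp_val \<Sigma> \<rho>) t \<phi> = 0" by (subst lin_expand) (auto intro!: sum.neutral)
    then show False using assms(2) by simp
  qed
  then show ?thesis using assms(1) by (auto simp: support_def)
qed

lemma support_lsum: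
  assumes "ps \<noteq> []" and "w \<in> support \<Sigma> (lsum ps)"
  shows "\<exists>(\<alpha>, t)\<in>set ps. w \<in> support \<Sigma> t"
proof -
  obtain \<rho> where \<rho>: "nat_assign \<Sigma> \<rho>"
    "(\<Sum>(\<alpha>, t)\<leftarrow>ps. amp_val \<Sigma> \<rho> \<alpha> * lin (amp_val \<Sigma> \<rho>) t (\<lambda>v. of_bool (v = w))) \<noteq> 0"
    using assms unfolding support_def by (auto simp: lin_lsum)
  then have "\<exists>p\<in>set ps. lin (amp_val \<Sigma> \<rho>) (snd p) (\<lambda>v. of_bool (v = w)) \<noteq> 0"
    by (induction ps) (auto split: prod.splits)
  then show ?thesis using \<rho>(1) unfolding support_def by fastforce
qed

text \<open>Distinct classical summands cannot cancel, so an assignment making \<alpha> non-zero is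
  a witness for \<open>t\<close>.\<close>

lemma canonical_support:
  assumes "canonical \<Sigma> ps" and "(\<alpha>, t) \<in> set ps"
  shows "t \<in> support \<Sigma> (lsum ps)"
proof -
  have c: "\<And>\<beta> s. (\<beta>, s) \<in> set ps \<Longrightarrow> classical s" and d: "distinct (map snd ps)" "ps \<noteq> []"
    and "\<not> amp_denotes \<Sigma> \<alpha> 0"
    using assms by (auto simp: canonical_def classical_trms_def)
  then obtain \<rho> where \<rho>: "nat_assign \<Sigma> \<rho>" "amp_val \<Sigma> \<rho> \<alpha> \<noteq> 0"
    using not_denotes_0 by blast
  have "lin (amp_val \<Sigma> \<rho>) (lsum ps) (\<lambda>v. of_bool (v = t)) =
      amp_val \<Sigma> \<rho> \<alpha> * lin (amp_val \<Sigma> \<rho>) t (\<lambda>v. of_bool (v = t))"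
    unfolding lin_lsum[OF d(2)]
    by (rule sum_list_distinct_snd[OF d(1) assms(2)]) (simp add: lin_classical c)
  then show ?thesis
    using \<rho> c[OF assms(2)] by (auto simp: support_def lin_classical)
qed

text \<open>The second conjunct is what transfers strictness: if some \<open>v\<close> in the
  support of \<open>t\<close> were above \<open>s\<close>, then so would be \<open>t\<close>,
  against a strict step from \<open>s\<close> to \<open>t\<close>.\<close>

lemma worst_path_support:
  assumes "(s, t) \<in> worst_path \<Sigma> geq" and "s \<in> classical_trms \<Sigma>" and "v \<in> support \<Sigma> t"
  shows "(s, v) \<in> geq \<and> ((v, s) \<in> geq \<longrightarrow> (t, s) \<in> worst_path \<Sigma> geq)"
  using assms
proof (induction rule: worst_path.induct)
  case (wp_classical s t)
  then show ?case
    by (auto simp: support_classical classical_trms_def intro: worst_path.wp_classical)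
next
  case (wp_left s ps t)
  then obtain \<alpha> s' where s': "(\<alpha>, s') \<in> set ps"
    "s' \<in> classical_trms \<Sigma> \<Longrightarrow> v \<in> support \<Sigma> t \<Longrightarrow>
       (s', v) \<in> geq \<and> ((v, s') \<in> geq \<longrightarrow> (t, s') \<in> worst_path \<Sigma> geq)"
    by blast
  \<comment> \<open>Since \<open>s\<close> is classical, its support is a singleton, so a canonical
    form of \<open>s\<close> has no summand other than \<open>s\<close>.\<close>
  have "s' \<in> support \<Sigma> s"
    using canonical_support[OF wp_left(2) s'(1)] teq_support[OF wp_left(1)] by simp
  then have "s' = s"
    using wp_left.prems(1) by (simp add: classical_trms_def support_classical)
  then show ?case using s'(2) wp_left.prems by blast
next
  case (wp_right t ps s)
  have "ps \<noteq> []" and c: "\<And>\<beta> t'. (\<beta>, t') \<in> set ps \<Longrightarrow> t' \<in> classical_trms \<Sigma>"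
    using wp_right(2) by (auto simp: canonical_def)
  moreover have "v \<in> support \<Sigma> (lsum ps)"
    using wp_right.prems(2) teq_support[OF wp_right(1)] by simp
  ultimately obtain \<beta> t' where t': "(\<beta>, t') \<in> set ps" "v \<in> support \<Sigma> t'"
    using support_lsum by blast
  then have "v = t'" using c by (auto simp: classical_trms_def support_classical)
  have IH: "(s, v) \<in> geq \<and> ((v, s) \<in> geq \<longrightarrow> (t', s) \<in> worst_path \<Sigma> geq)"
    using wp_right.IH t' wp_right.prems(1) by blast
  then show ?case using worst_path.wp_left[OF wp_right(1,2)] t'(1) by blast
qed

lemma strict_worst_path_support:
  "(s, t) \<in> strict_of (worst_path \<Sigma> geq) \<Longrightarrow> s \<in> classical_trms \<Sigma> \<Longrightarrow> v \<in> support \<Sigma> t \<Longrightarrow>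
     (s, v) \<in> strict_of geq"
  using worst_path_support unfolding strict_of_def by blast


section \<open>Reducts of classical terms\<close>

text \<open>
  The assignment agrees with \<open>\<rho>\<close> after \<open>\<sigma>\<close> on the variables of the amplitudes of \<open>t\<close>; the value 0 on
  the other variables makes it an assignment of naturals.
\<close>

lemma lin_subst:
  fixes \<Sigma> :: "('a, 'c, 'f, 'x) signat" and \<sigma> \<rho> :: "'x \<Rightarrow> ('a, 'c, 'f, 'x) trm"
  defines "\<rho>' \<equiv> (\<lambda>x. if is_nat_trm \<Sigma> (\<sigma> x) then subst \<rho> (\<sigma> x) else App (Constr CZero) [])"
  shows "(\<And>x. classical (\<sigma> x)) \<Longrightarrow> wf_trm \<Sigma> (subst \<sigma> t) \<Longrightarrow>
      lin (amp_val \<Sigma> \<rho>) (subst \<sigma> t) \<phi> = lin (amp_val \<Sigma> \<rho>') t (\<lambda>v. \<phi> (subst \<sigma> v))"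
    and "(\<And>x. classical (\<sigma> x)) \<Longrightarrow> (\<forall>t\<in>set ts. wf_trm \<Sigma> (subst \<sigma> t)) \<Longrightarrow>
      lins (amp_val \<Sigma> \<rho>) (map (subst \<sigma>) ts) \<psi> =
      lins (amp_val \<Sigma> \<rho>') ts (\<lambda>vs. \<psi> (map (subst \<sigma>) vs))"
proof (induction t and ts arbitrary: \<phi> and \<psi> rule: summands_summands_list.induct)
  case (3 \<alpha> t)
  have "amp_subst \<rho> (amp_subst \<sigma> \<alpha>) = amp_subst \<rho>' \<alpha>"
    unfolding subst_subst
    using 3(3) wf_amp_subst_vars[of \<Sigma> \<sigma> \<alpha>] by (intro subst_cong) (auto simp: \<rho>'_def)
  then show ?case using 3 by simp
qed (simp_all add: lin_classical)

text \<open>Classical values send classical terms to classical terms, so the coefficient of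
  \<open>w\<close> is the value of \<open>t\<close> at the indicator of \<open>w\<close> composed
  with the substitution.\<close>

lemma support_subst:
  assumes "\<And>x. classical (\<sigma> x)" and "wf_trm \<Sigma> (subst \<sigma> t)" and "w \<in> support \<Sigma> (subst \<sigma> t)"
  shows "\<exists>v\<in>support \<Sigma> t. w = subst \<sigma> v"
proof -
  obtain \<rho> where \<rho>: "nat_assign \<Sigma> \<rho>"
    "lin (amp_val \<Sigma> \<rho>) (subst \<sigma> t) (\<lambda>v. of_bool (v = w)) \<noteq> 0"
    using assms(3) by (auto simp: support_def)
  let ?\<rho>' = "\<lambda>x. if is_nat_trm \<Sigma> (\<sigma> x) then subst \<rho> (\<sigma> x) else App (Constr CZero) []"
  have "nat_assign \<Sigma> ?\<rho>'"
    using is_nat_subst[OF \<rho>(1)] by (auto simp: nat_assign_def)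
  from lin_nonzero_support[OF this \<rho>(2)[unfolded lin_subst(1)[OF assms(1,2)]]]
  show ?thesis by auto
qed

text \<open>The term \<open>u\<close> only witnesses that the side arguments of \<open>E\<close> are
  classical; \<open>t\<close> may be any superposition.\<close>

lemma lin_plug:
  "classical (plug E u) \<Longrightarrow> lin A (plug E t) \<phi> = lin A t (\<lambda>v. \<phi> (plug E v))"
  by (induction E arbitrary: \<phi>) (auto simp: lins_append lin_classical)

lemma support_plug:
  assumes "classical (plug E u)" and "w \<in> support \<Sigma> (plug E t)"
  shows "\<exists>v\<in>support \<Sigma> t. w = plug E v"
proof -
  obtain \<rho> where \<rho>: "nat_assign \<Sigma> \<rho>"
    "lin (amp_val \<Sigma> \<rho>) (plug E t) (\<lambda>v. of_bool (v = w)) \<noteq> 0"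
    using assms(2) by (auto simp: support_def)
  from lin_nonzero_support[OF \<rho>(1) \<rho>(2)[unfolded lin_plug[OF assms(1)]]]
  show ?thesis by auto
qed

section \<open>Contexts, patterns and classical steps\<close>

lemma classical_trms_plugD: "plug E s \<in> classical_trms \<Sigma> \<Longrightarrow> s \<in> classical_trms \<Sigma>"
  by (induction E) (auto simp: classical_trms_def)

lemma monotonic_plug:
  assumes "monotonic \<Sigma> gt" and "(s, t) \<in> gt"
  shows "plug E s \<in> classical_trms \<Sigma> \<Longrightarrow> (plug E s, plug E t) \<in> gt"
proof (induction E)
  case (CApp b vs E ts)
  then have "plug E s \<in> classical_trms \<Sigma>" by (simp add: classical_trms_def)
  then show ?case using CApp assms(1) unfolding monotonic_def by simp
qed (use assms(2) in simp)

lemma classical_pattern: "is_pattern p \<Longrightarrow> classical p"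
  by (induction p rule: is_pattern.induct) auto

lemma is_ruleD:
  assumes "is_rule \<Sigma> (l, r)"
  shows "l \<in> classical_trms \<Sigma>" and "vars r \<subseteq> vars l"
proof -
  obtain f ps where l: "l = App (Func f) ps" and ps: "\<forall>p\<in>set ps. is_pattern p"
    using assms by (auto simp: is_rule_def)
  have "classical l" using ps by (simp add: l classical_pattern)
  then show "l \<in> classical_trms \<Sigma>" "vars r \<subseteq> vars l"
    using assms by (auto simp: is_rule_def classical_trms_def)
qed

lemma value_pattern_subst:
  "is_subst \<Sigma> \<sigma> \<Longrightarrow> is_pattern p \<Longrightarrow> wf_trm \<Sigma> p \<Longrightarrow> is_value (subst \<sigma> p)"
  by (induction p rule: is_pattern.induct) (auto simp: is_subst_def)

lemma classical_subst_vars: "classical (subst \<sigma> t) \<Longrightarrow> x \<in> vars t \<Longrightarrow> classical t \<Longrightarrow> classical (\<sigma> x)"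
  by (induction t rule: classical.induct) auto

lemma subst_eq_vars:
  "classical t \<Longrightarrow> subst \<sigma> t = subst \<tau> t \<Longrightarrow> x \<in> vars t \<Longrightarrow> \<sigma> x = \<tau> x"
  by (induction t rule: classical.induct) auto

text \<open>Rule \<open>red_C\<close> on its own, with the reduct that \<open>C_reducible\<close>
  hides; no set of normal forms is involved.\<close>

definition C_step ::
  "('a, 'c, 'f, 'x) signat \<Rightarrow> ('a, 'c, 'f, 'x) rule set \<Rightarrow>
    ('a, 'c, 'f, 'x) trm \<Rightarrow> ('a, 'c, 'f, 'x) trm \<Rightarrow> bool" where
  "C_step \<Sigma> \<R> s t \<longleftrightarrow>
     (\<exists>l r \<sigma> E. s = plug E (subst \<sigma> l) \<and> t = plug E (subst \<sigma> r) \<and> (l, r) \<in> \<R> \<and>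
        is_subst \<Sigma> \<sigma> \<and> is_ectx E \<and> classical s \<and> s \<in> ground_trms \<Sigma> \<and> t \<in> ground_trms \<Sigma>)"

lemma C_reducible_iff: "C_reducible \<Sigma> \<R> s \<longleftrightarrow> (\<exists>t. C_step \<Sigma> \<R> s t)"
  unfolding C_reducible_def C_step_def by blast

lemma wf_plugD: "wf_trm \<Sigma> (plug E s) \<Longrightarrow> wf_trm \<Sigma> s"
  by (induction E) auto

text \<open>Such a \<open>w\<close> has the form \<open>plug E (subst \<tau> v)\<close> with
  \<open>v\<close> in the support of \<open>r\<close>. As \<open>l\<close> is above
  \<open>v\<close>, closure under substitutions and monotonicity give the claim.\<close>

lemma C_step_decreasing:
  assumes rules: "\<And>\<rho>. \<rho> \<in> \<R> \<Longrightarrow> is_rule \<Sigma> \<rho>"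
    and order: "rewrite_order \<Sigma> (strict_of geq)"
    and compat: "compatible \<R> (strict_of (worst_path \<Sigma> geq))"
    and step: "C_step \<Sigma> \<R> s t" and w: "w \<in> support \<Sigma> t"
  shows "(s, w) \<in> strict_of geq"
proof -
  obtain l r \<sigma> E where s: "s = plug E (subst \<sigma> l)" and t: "t = plug E (subst \<sigma> r)"
    and rule: "(l, r) \<in> \<R>" and \<sigma>: "is_subst \<Sigma> \<sigma>" and cs: "s \<in> classical_trms \<Sigma>"
    and wft: "wf_trm \<Sigma> t"
    using step unfolding C_step_def ground_trms_def classical_trms_def by blast
  have l: "l \<in> classical_trms \<Sigma>" and vr: "vars r \<subseteq> vars l"
    using is_ruleD[OF rules[OF rule]] .
  \<comment> \<open>Classicality of the redex constrains \<sigma> only on the variables of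
    \<open>l\<close>, whereas closure under substitutions asks for classical values everywhere;
    \<open>CUnit\<close> is an arbitrary choice of such a value.\<close>
  define \<tau> where "\<tau> = (\<lambda>x. if x \<in> vars l then \<sigma> x else App (Constr CUnit) [])"
  have eqs: "subst \<sigma> l = subst \<tau> l" "subst \<sigma> r = subst \<tau> r"
    using vr by (auto simp: \<tau>_def intro!: subst_cong)
  have "classical (subst \<sigma> l)"
    using classical_trms_plugD cs s by (auto simp: classical_trms_def)
  then have c\<tau>: "\<And>x. classical (\<tau> x)"
    using classical_subst_vars l by (auto simp: \<tau>_def classical_trms_def)
  have s\<tau>: "is_subst \<Sigma> \<tau>"
    using \<sigma> by (auto simp: is_subst_def \<tau>_def symbs_def)
  obtain v' where v': "v' \<in> support \<Sigma> (subst \<tau> r)" "w = plug E v'"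
    using support_plug[of E "subst \<sigma> l" w \<Sigma> "subst \<tau> r"] w cs eqs s t
    by (auto simp: classical_trms_def)
  have "wf_trm \<Sigma> (subst \<tau> r)"
    using wft wf_plugD by (auto simp: t eqs)
  then obtain v where v: "v \<in> support \<Sigma> r" "v' = subst \<tau> v"
    using support_subst c\<tau> v'(1) by blast
  have "(l, r) \<in> strict_of (worst_path \<Sigma> geq)"
    using compat rule by (auto simp: compatible_def)
  then have "(l, v) \<in> strict_of geq"
    using strict_worst_path_support l v(1) by blast
  then have "(subst \<tau> l, subst \<tau> v) \<in> strict_of geq"
    using order s\<tau> c\<tau> by (simp add: rewrite_order_def subst_closed_def)
  then show ?thesis
    using order cs by (auto simp: rewrite_order_def s eqs v v'(2) intro: monotonic_plug)
qed

section \<open>Uniqueness of the classical reduct\<close>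

lemma not_value_plug: "is_value (plug E (App (Func f) ts)) \<Longrightarrow> False"
  by (induction E) (auto elim: is_value.elims)

text \<open>The split is at the first element violating \<open>P\<close>. With
  \<open>is_value\<close> for \<open>P\<close> it locates the hole of an evaluation context.\<close>

lemma append_Cons_first_eq:
  assumes "xs @ y # zs = xs' @ y' # zs'"
    and "\<forall>x\<in>set xs. P x" and "\<not> P y" and "\<forall>x\<in>set xs'. P x" and "\<not> P y'"
  shows "xs = xs' \<and> y = y' \<and> zs = zs'"
  using assms by (induction xs arbitrary: xs') (auto simp: Cons_eq_append_conv split: if_splits)

text \<open>At each level the hole is at the first argument that is not a value, and it cannot lie
  below a redex because the arguments of a redex are values.\<close>

lemma plug_inj:
  "is_ectx E \<Longrightarrow> is_ectx E' \<Longrightarrow> \<forall>v\<in>set vs. is_value v \<Longrightarrow> \<forall>v\<in>set vs'. is_value v \<Longrightarrow>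
     plug E (App (Func f) vs) = plug E' (App (Func f') vs') \<Longrightarrow>
     E = E' \<and> App (Func f) vs = App (Func f') vs'"
proof (induction E arbitrary: E')
  case Hole
  show ?case
  proof (cases E')
    case (CApp b ws E'' ts)
    then have "is_value (plug E'' (App (Func f') vs'))" using Hole by auto
    then show ?thesis using not_value_plug[of E'' f' vs'] by blast
  qed (use Hole in auto)
next
  case (CApp b ws E ts)
  show ?case
  proof (cases E')
    case Hole
    then have "is_value (plug E (App (Func f) vs))" using CApp by auto
    then show ?thesis using not_value_plug[of E f vs] by blast
  next
    case (CApp b' ws' E'' ts')
    have "ws @ plug E (App (Func f) vs) # ts = ws' @ plug E'' (App (Func f') vs') # ts'"
      using CApp CApp.prems(5) by simp
    from append_Cons_first_eq[OF this, where P = is_value]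
    have "ws = ws' \<and> plug E (App (Func f) vs) = plug E'' (App (Func f') vs') \<and> ts = ts'"
      using CApp CApp.prems(1,2) not_value_plug[of E f vs] not_value_plug[of E'' f' vs'] by auto
    then show ?thesis
      using CApp CApp.IH[of E''] CApp.prems by auto
  qed
qed

lemma C_step_deterministic:
  assumes strs: "is_strs \<Sigma> \<R> f" and "C_step \<Sigma> \<R> s t" and "C_step \<Sigma> \<R> s t'"
  shows "t = t'"
proof -
  obtain l r \<sigma> E where 1: "s = plug E (subst \<sigma> l)" "t = plug E (subst \<sigma> r)" "(l, r) \<in> \<R>"
    "is_subst \<Sigma> \<sigma>" "is_ectx E"
    using assms(2) unfolding C_step_def by blast
  obtain l' r' \<sigma>' E' where 2: "s = plug E' (subst \<sigma>' l')" "t' = plug E' (subst \<sigma>' r')"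
    "(l', r') \<in> \<R>" "is_subst \<Sigma> \<sigma>'" "is_ectx E'"
    using assms(3) unfolding C_step_def by blast
  \<comment> \<open>Patterns instantiated by values are values, which is what
    \<open>plug_inj\<close> needs.\<close>
  have redex: "\<exists>f vs. subst \<sigma> l = App (Func f) vs \<and> (\<forall>v\<in>set vs. is_value v)"
    if "(l, r) \<in> \<R>" "is_subst \<Sigma> \<sigma>" for l r \<sigma>
    using that strs value_pattern_subst[of \<Sigma> \<sigma>] by (fastforce simp: is_strs_def is_rule_def)
  have E: "E = E'" "subst \<sigma> l = subst \<sigma>' l'"
    using redex[OF 1(3,4)] redex[OF 2(3,4)] plug_inj[OF 1(5) 2(5)] 1(1) 2(1) by metis+
  have rule: "is_rule \<Sigma> (l, r)" using strs 1(3) by (auto simp: is_strs_def)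
  \<comment> \<open>Two rules matching the same redex overlap at the root, so orthogonality
    identifies them.\<close>
  have "overlaps \<Sigma> l l'"
    unfolding overlaps_def
  proof (intro bexI exI conjI)
    show "l \<in> subtrms l" "\<nexists>x. l = Var x" using rule by (auto simp: is_rule_def)
  qed (use E(2) 1(4) 2(4) in \<open>auto simp: is_subst_def\<close>)
  then have same: "(l, r) = (l', r')"
    using strs 1(3) 2(3) unfolding is_strs_def orthogonal_def by fastforce
  have "classical l" using is_ruleD(1)[OF rule] by (simp add: classical_trms_def)
  moreover have "subst \<sigma> l = subst \<sigma>' l" using E(2) same by simp
  ultimately have "\<sigma> x = \<sigma>' x" if "x \<in> vars r" for x
    by (rule subst_eq_vars) (use that is_ruleD(2)[OF rule] in blast)
  then have "subst \<sigma> r = subst \<sigma>' r" by (rule subst_cong(1))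
  then show ?thesis using 1 2 E same by simp
qed


section \<open>Termination\<close>

text \<open>Every reducible support element of the reduct descends from a reducible one that was
  itself rewritten: an element kept through \<open>N\<close> is irreducible by assumption. The claim
  depends on supports only, hence is stable under equivalence.\<close>

lemma red_wrt_support:
  assumes "red_wrt \<Sigma> \<R> N s t" and "\<And>u. u \<in> N \<Longrightarrow> \<not> C_reducible \<Sigma> \<R> u"
  shows "(\<exists>u\<in>support \<Sigma> s. C_reducible \<Sigma> \<R> u) \<and>
    (\<forall>w\<in>support \<Sigma> t. C_reducible \<Sigma> \<R> w \<longrightarrow>
       (\<exists>u\<in>support \<Sigma> s. \<exists>t. C_step \<Sigma> \<R> u t \<and> w \<in> support \<Sigma> t))"
  using assms(1)
proof (induction rule: red_wrt.induct)
  case (red_C l r \<sigma> E)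
  then have "C_step \<Sigma> \<R> (plug E (subst \<sigma> l)) (plug E (subst \<sigma> r))"
    unfolding C_step_def by blast
  then show ?case using red_C(4) by (auto simp: support_classical C_reducible_iff)
next
  case (red_E s t s' t')
  then show ?case using teq_support by metis
next
  case (red_Q ps)
  let ?P = "\<lambda>s t. (\<exists>u\<in>support \<Sigma> s. C_reducible \<Sigma> \<R> u) \<and>
    (\<forall>w\<in>support \<Sigma> t. C_reducible \<Sigma> \<R> w \<longrightarrow>
       (\<exists>u\<in>support \<Sigma> s. \<exists>t. C_step \<Sigma> \<R> u t \<and> w \<in> support \<Sigma> t))"
  let ?s = "lsum (map (\<lambda>(\<alpha>, s, t). (\<alpha>, s)) ps)"
  let ?t = "lsum (map (\<lambda>(\<alpha>, s, t). (\<alpha>, t)) ps)"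
  have summand: "support \<Sigma> s = {s} \<and> s \<in> support \<Sigma> ?s" if "(\<alpha>, s, t) \<in> set ps" for \<alpha> s t
  proof -
    have "(\<alpha>, s) \<in> set (map (\<lambda>(\<alpha>, s, t). (\<alpha>, s)) ps)" using that by force
    moreover from this have "classical s"
      using red_Q(1) unfolding canonical_def classical_trms_def by blast
    ultimately show ?thesis using canonical_support[OF red_Q(1)] support_classical by blast
  qed
  have "\<exists>u\<in>support \<Sigma> ?s. C_reducible \<Sigma> \<R> u"
    using red_Q(4) summand by fastforce
  moreover have "\<exists>u\<in>support \<Sigma> ?s. \<exists>t. C_step \<Sigma> \<R> u t \<and> w \<in> support \<Sigma> t"
    if w: "w \<in> support \<Sigma> ?t" "C_reducible \<Sigma> \<R> w" for w
  proof -
    \<comment> \<open>The reducts may share terms or cancel, so the new sum need not be canonical;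
      each of its support elements still comes from the support of a single reduct.\<close>
    have "ps \<noteq> []" using red_Q(1) by (auto simp: canonical_def)
    then obtain \<alpha> s t where p: "(\<alpha>, s, t) \<in> set ps" "w \<in> support \<Sigma> t"
      using support_lsum[OF _ w(1)] by fastforce
    have "s \<in> N \<and> t = s \<or> ?P s t" using red_Q(3) p(1) by blast
    then show ?thesis
    proof
      assume "s \<in> N \<and> t = s"
      then show ?thesis using p summand[OF p(1)] assms(2) w(2) by auto
    next
      assume "?P s t"
      then have "\<exists>t. C_step \<Sigma> \<R> s t \<and> w \<in> support \<Sigma> t"
        using p w(2) summand[OF p(1)] by auto
      then show ?thesis using summand[OF p(1)] by blast
    qed
  qed
  ultimately show ?case by blast
qed

lemma NF_not_C_reducible: "u \<in> NF \<Sigma> \<R> \<Longrightarrow> \<not> C_reducible \<Sigma> \<R> u"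
proof
  assume u: "u \<in> NF \<Sigma> \<R>" "C_reducible \<Sigma> \<R> u"
  then have "classical u" by (auto simp: C_reducible_def)
  then have "\<exists>t. red \<Sigma> \<R> u t"
    using u(2) by (subst red_unfold) (simp add: red_wrt_classical_iff)
  then show False using u(1) by (simp add: NF_def NF_of_def)
qed

lemma red_support:
  assumes "red \<Sigma> \<R> s t"
  shows "\<exists>u\<in>support \<Sigma> s. C_reducible \<Sigma> \<R> u"
    and "w \<in> support \<Sigma> t \<Longrightarrow> C_reducible \<Sigma> \<R> w \<Longrightarrow>
      \<exists>u\<in>support \<Sigma> s. \<exists>t. C_step \<Sigma> \<R> u t \<and> w \<in> support \<Sigma> t"
proof -
  have "red_wrt \<Sigma> \<R> (NF \<Sigma> \<R>) s t" using assms by (subst (asm) red_unfold)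
  from red_wrt_support[OF this NF_not_C_reducible]
  show "\<exists>u\<in>support \<Sigma> s. C_reducible \<Sigma> \<R> u"
    and "w \<in> support \<Sigma> t \<Longrightarrow> C_reducible \<Sigma> \<R> w \<Longrightarrow>
      \<exists>u\<in>support \<Sigma> s. \<exists>t. C_step \<Sigma> \<R> u t \<and> w \<in> support \<Sigma> t"
    by blast+
qed

text \<open>The height is defined by well-founded recursion as the maximum of the successors of the
  heights below; finite branching keeps it a natural. Inserting 0 covers minimal elements.\<close>

lemma wf_finite_height:
  assumes "wf R" and fin: "\<And>u. finite {w. (w, u) \<in> R}"
  shows "\<exists>h :: 'b \<Rightarrow> nat. \<forall>(w, u)\<in>R. h w < h u"
proof -
  define h where "h = wfrec R (\<lambda>h u. Max (insert 0 ((\<lambda>w. Suc (h w)) ` {w. (w, u) \<in> R})))"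
  have h: "h u = Max (insert 0 ((\<lambda>w. Suc (h w)) ` {w. (w, u) \<in> R}))" for u
  proof -
    have "(\<lambda>w. Suc (cut h R u w)) ` {w. (w, u) \<in> R} = (\<lambda>w. Suc (h w)) ` {w. (w, u) \<in> R}"
      by (rule image_cong) (auto simp: cut_apply)
    then show ?thesis
      by (subst def_wfrec[OF eq_reflection[OF h_def] assms(1)]) simp
  qed
  have "h w < h u" if "(w, u) \<in> R" for w u
  proof -
    have "Suc (h w) \<le> h u"
      unfolding h[of u] using that fin by (intro Max_ge) auto
    then show ?thesis by simp
  qed
  then show ?thesis by blast
qed

theorem theorem31:
  fixes \<Sigma> :: "('a, 'c, 'f, 'x) signat"
    and \<R> :: "('a, 'c, 'f, 'x) rule set"
    and f :: 'f
    and geq :: "(('a, 'c, 'f, 'x) trm \<times> ('a, 'c, 'f, 'x) trm) set"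
  assumes "preorder_on (classical_trms \<Sigma>) geq"
    and "no_infinite_chain (strict_of geq)"
    and "rewrite_order \<Sigma> (strict_of geq)"
    and "is_strs \<Sigma> \<R> f"
    and "compatible \<R> (strict_of (worst_path \<Sigma> geq))"
  shows "strs_terminates \<Sigma> \<R>"
proof -
  \<comment> \<open>The smaller term comes first, as \<open>wf\<close> expects.\<close>
  define R where "R = {(w, u). \<exists>t. C_step \<Sigma> \<R> u t \<and> w \<in> support \<Sigma> t}"
  have "R \<subseteq> (strict_of geq)\<inverse>"
    using C_step_decreasing assms(3-5) unfolding R_def is_strs_def by blast
  moreover have "wf ((strict_of geq)\<inverse>)"
    using assms(2) by (simp add: wf_iff_no_infinite_down_chain no_infinite_chain_def)
  ultimately have "wf R" using wf_subset by blast
  moreover have "finite {w. (w, u) \<in> R}" for u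
  proof (cases "\<exists>t. C_step \<Sigma> \<R> u t")
    case True
    then obtain t where t: "C_step \<Sigma> \<R> u t" by blast
    then have "{w. (w, u) \<in> R} \<subseteq> support \<Sigma> t"
      using C_step_deterministic[OF assms(4)] by (auto simp: R_def)
    then show ?thesis using finite_support finite_subset by blast
  qed (simp add: R_def)
  ultimately have "\<exists>h :: _ \<Rightarrow> nat. \<forall>(w, u)\<in>R. h w < h u" by (rule wf_finite_height)
  then obtain h :: "_ \<Rightarrow> nat" where h: "\<And>w u. (w, u) \<in> R \<Longrightarrow> h w < h u" by fast
  \<comment> \<open>Irreducible support elements are left out: they may persist along a chain with
    constant height.\<close>
  define bounded where
    "bounded = (\<lambda>k s. \<forall>u\<in>support \<Sigma> s. C_reducible \<Sigma> \<R> u \<longrightarrow> h u < k)"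
  have bounded_0: "\<not> red \<Sigma> \<R> s t" if "bounded 0 s" for s t
    using that red_support(1) by (fastforce simp: bounded_def)
  have bounded_Suc: "bounded k t" if st: "bounded (Suc k) s" "red \<Sigma> \<R> s t" for k s t
    unfolding bounded_def
  proof (intro ballI impI)
    fix w assume "w \<in> support \<Sigma> t" "C_reducible \<Sigma> \<R> w"
    then obtain u t' where u: "u \<in> support \<Sigma> s" "C_step \<Sigma> \<R> u t'" "w \<in> support \<Sigma> t'"
      using red_support(2)[OF st(2)] by blast
    then have "h w < h u" using h by (auto simp: R_def)
    moreover have "h u < Suc k"
      using st(1) u by (auto simp: bounded_def C_reducible_iff)
    ultimately show "h w < k" by simp
  qed
  \<comment> \<open>The induction drops the first element of the chain, hence the generalization
    over \<open>ch\<close>.\<close>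
  have chain: "\<exists>i\<le>k. ch i \<in> NF \<Sigma> \<R>"
    if "bounded k (ch 0)" "\<forall>i. red_opt \<Sigma> \<R> (ch i) (ch (Suc i))" for k ch
    using that
  proof (induction k arbitrary: ch)
    case 0
    then show ?case using bounded_0 by (auto simp: red_opt_def)
  next
    case (Suc k)
    consider "ch 0 \<in> NF \<Sigma> \<R>" | "red \<Sigma> \<R> (ch 0) (ch (Suc 0))"
      using Suc.prems(2) by (auto simp: red_opt_def)
    then show ?case
    proof cases
      case 2
      then have "\<exists>i\<le>k. ch (Suc i) \<in> NF \<Sigma> \<R>"
        using Suc.IH[of "\<lambda>i. ch (Suc i)"] Suc.prems bounded_Suc by simp
      then show ?thesis by (meson Suc_le_mono)
    qed blast
  qed
  show ?thesis
    unfolding strs_terminates_def terminates_def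
  proof (intro ballI)
    fix t
    \<comment> \<open>The support may be empty; \<open>Max\<close> is then unspecified, but the
      bound holds vacuously.\<close>
    have "\<forall>u\<in>support \<Sigma> t. h u < Suc (Max (h ` support \<Sigma> t))"
      by (simp add: less_Suc_eq_le finite_support)
    then have "bounded (Suc (Max (h ` support \<Sigma> t))) t"
      by (auto simp: bounded_def)
    then show "\<exists>k. \<forall>ch. ch 0 = t \<and> (\<forall>i. red_opt \<Sigma> \<R> (ch i) (ch (Suc i))) \<longrightarrow>
        (\<exists>i\<le>k. ch i \<in> NF \<Sigma> \<R>)"
      by (intro exI[of _ "Suc (Max (h ` support \<Sigma> t))"] allI impI chain) simp_all
  qed
qed

end
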